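(* For first-passage percolation on the ladder $\mathcal{G}^{\{\mathcal{X},\mathcal{Y},\mathcal{Z}\}}$ with independent standard exponential edge weights, almost surely $$\chi=\lim_{n\to\infty}\frac{l_n}{n}=\frac32-\frac{\mathrm{J}_1(2)}{2\,\mathrm{J}_2(2)}\approx 0.68,$$ where $\mathrm{J}_\nu$ is the Bessel function of the first kind of order $\nu$.
   Context: Ladder model $\mathcal{G}^{\{\mathcal{X},\mathcal{Y},\mathcal{Z}\}}$: for $n\ge0$, $G_n$ has vertex set $\{0,\dots,n\}\times\{0,1\}$ and edges: for $1\le i\le n$, an edge joining $(i-1,0)$ and $(i,0)$, an edge joining $(i-1,1)$ and $(i,1)$; for $0\le i\le n$, an edge joining $(i,0)$ and $(i,1)$. All edge weights are independent standard exponential random variables (density $e^{-x}$, $x>0$). Path weight = sum of edge weights; $l_n$ is the minimal weight of a path in $G_n$ from $(0,0)$ to $(n,0)$. *)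

theory Defs
  imports "HOL-Probability.Probability"
begin

definition besselJ :: "nat \<Rightarrow> real \<Rightarrow> real" where
  "besselJ \<nu> x = (\<Sum>k. (-1) ^ k / (fact k * fact (k + \<nu>)) * (x / 2) ^ (2 * k + \<nu>))"

datatype ladder_edge = Bot nat | Top nat | Rung nat

fun ends :: "ladder_edge \<Rightarrow> (nat \<times> nat) set" where
  "ends (Bot i) = {(i - 1, 0), (i, 0)}"
| "ends (Top i) = {(i - 1, 1), (i, 1)}"
| "ends (Rung i) = {(i, 0), (i, 1)}"

definition ladder_edges :: "nat \<Rightarrow> ladder_edge set" where
  "ladder_edges n = {Bot i | i. 1 \<le> i \<and> i \<le> n} \<union> {Top i | i. 1 \<le> i \<and> i \<le> n}
                    \<union> {Rung i | i. i \<le> n}"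

definition is_ladder_path :: "nat \<Rightarrow> (nat \<times> nat) list \<Rightarrow> bool" where
  "is_ladder_path n vs \<longleftrightarrow> vs \<noteq> [] \<and> distinct vs \<and> hd vs = (0, 0) \<and> last vs = (n, 0) \<and>
     (\<forall>i. Suc i < length vs \<longrightarrow> (\<exists>e\<in>ladder_edges n. ends e = {vs ! i, vs ! Suc i}))"

definition edge_between :: "nat \<Rightarrow> nat \<times> nat \<Rightarrow> nat \<times> nat \<Rightarrow> ladder_edge" where
  "edge_between n u v = (THE e. e \<in> ladder_edges n \<and> ends e = {u, v})"

definition path_weight :: "(ladder_edge \<Rightarrow> real) \<Rightarrow> nat \<Rightarrow> (nat \<times> nat) list \<Rightarrow> real" where
  "path_weight t n vs = (\<Sum>i<length vs - 1. t (edge_between n (vs ! i) (vs ! Suc i)))"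

definition passage_time :: "(ladder_edge \<Rightarrow> real) \<Rightarrow> nat \<Rightarrow> real" where
  "passage_time t n = Min (path_weight t n ` {vs. is_ladder_path n vs})"

end

(*
  A shortest path crosses every column gap exactly once, so the passage times a_n, b_n from (0,0) to
  (n,0), (n,1) satisfy a recursion driven by the edge weights of column n. Put T_n = min(a_n, b_n) and
  U_n = |b_n - a_n|. Then T_{n+1} - T_n = min(X, U_n + Y) and U_{n+1} = min(|U_n + Y - X|, Z) with
  independent exponential X, Y, Z, hence with x = exp(-u)

    E[min(X, u + Y)] = 1 - x/2,
    E[exp(-m min(|u + Y - X|, Z))] = 1/(m+1) + x/(m+2) - x^(m+1)/((m+1)(m+2)).

  So the Poisson equation E[T_{n+1} - T_n + h(U_{n+1}) - h(U_n) | U_n = u] = chi can be solved by a power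
  series h in exp(-u): the coefficient recursion makes it a Bessel-type series, its linear coefficient
  fixes the normalisation 1/(2 J_2(2)), and its constant term gives the value of chi. With this bounded
  corrector h, T_n + h(U_n) - n chi has orthogonal increments with bounded second moments, so it is o(n)
  along the squares, and the monotonicity of T_n fills the gaps. No stationary distribution or ergodic
  theorem is involved.
*)
theory Submission
  imports Defs "HOL-Real_Asymp.Real_Asymp"
begin

section \<open>Passage times in the ladder\<close>

text \<open>Up to a constant and a linear term, one step sends x^m to -x^(m+1)/((m+1)(m+2)), so it
  only raises the degree. For h = sum c_k x^(k+1), degrees >= 2 of the Poisson equation give c_(k+1)
  = -c_k/((k+2)(k+3)) and leave c_0 free. Degree 1 reads c_0 = -1/2 + sum c_k/(k+3), which forces
  c_0 = -1/(4 J_2(2)) and makes J_2(2) > 0 a fact to be proved. Degree 0 reads chi = 1 + sum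
  c_k/(k+2) = 1 - J_0(2)/(2 J_2(2)), and J_0(2) = J_1(2) - J_2(2) turns this into the closed form.

  Two obstacles shape the rest. That turning back never pays is not derived from the shape of paths:
  the lower bound on path weights comes from a distance function of the whole ladder that is
  1-Lipschitz along every edge. And the passage time to (n,0) need not increase with n, whereas T_n
  does; so the interpolation between squares is done for T_n, and the difference, at most the weight
  of the last rung, is removed separately.\<close>

lemma ends_inj:
  assumes "e \<in> ladder_edges n" "e' \<in> ladder_edges n" "ends e = ends e'"
  shows "e = e'"
  using assms unfolding ladder_edges_def
  by (cases e; cases e') (auto simp: doubleton_eq_iff)

text \<open>Injectivity of \<open>ends\<close> on the ladder turns the definite description into a
  rule for computing path weights edge by edge.\<close>

lemma edge_between_eq:
  assumes "e \<in> ladder_edges n" "ends e = {u, v}"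
  shows "edge_between n u v = e"
  unfolding edge_between_def using assms by (intro the_equality) (auto intro: ends_inj)

definition ladder_step :: "real \<times> real \<Rightarrow> real \<times> real \<times> real \<Rightarrow> real \<times> real" where
  "ladder_step = (\<lambda>(a, b) (x, y, z). (min (a + x) (b + y + z), min (b + y) (a + x + z)))"

primrec front :: "(ladder_edge \<Rightarrow> real) \<Rightarrow> nat \<Rightarrow> real \<times> real" where
  "front t 0 = (0, t (Rung 0))"
| "front t (Suc n) = ladder_step (front t n) (t (Bot (Suc n)), t (Top (Suc n)), t (Rung (Suc n)))"

lemma fst_front_Suc: "fst (front t (Suc n)) =
    min (fst (front t n) + t (Bot (Suc n))) (snd (front t n) + t (Top (Suc n)) + t (Rung (Suc n)))"
  by (simp add: ladder_step_def split: prod.split)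

lemma snd_front_Suc: "snd (front t (Suc n)) =
    min (snd (front t n) + t (Top (Suc n))) (fst (front t n) + t (Bot (Suc n)) + t (Rung (Suc n)))"
  by (simp add: ladder_step_def split: prod.split)

text \<open>The last rung joins the two endpoints, so either distance exceeds the other by at most
  its weight.\<close>

lemma front_gap:
  assumes "\<And>e. 0 \<le> t e"
  shows "\<bar>snd (front t n) - fst (front t n)\<bar> \<le> t (Rung n)"
proof (cases n)
  case (Suc m)
  then show ?thesis
    using assms[of "Rung n"] by (simp only: fst_front_Suc snd_front_Suc)
qed (use assms[of "Rung 0"] in auto)

section \<open>Distances in the whole ladder, as a lower bound for path weights\<close>

text \<open>
  The cheapest way from one end of rung \<open>i\<close> to the other inside the columns \<open>i, \<dots>, n\<close>.
  The distance from the origin within the whole ladder may use such a detour, so for \<open>i < n\<close> it can be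
  smaller than the entries of \<open>front t i\<close>; \<open>ladder_dist\<close> below takes this into account.
\<close>

function right_detour :: "(ladder_edge \<Rightarrow> real) \<Rightarrow> nat \<Rightarrow> nat \<Rightarrow> real" where
  "right_detour t n i = (if n \<le> i then t (Rung i)
     else min (t (Rung i)) (t (Bot (Suc i)) + t (Top (Suc i)) + right_detour t n (Suc i)))"
  by auto
termination by (relation "Wellfounded.measure (\<lambda>(t, n, i). n - i)") auto

declare right_detour.simps [simp del]

lemma right_detour_le: "right_detour t n i \<le> t (Rung i)"
  by (subst right_detour.simps) auto

lemma right_detour_end: "right_detour t n n = t (Rung n)"
  by (subst right_detour.simps) auto

lemma right_detour_step:
  "i < n \<Longrightarrow> right_detour t n i =
    min (t (Rung i)) (t (Bot (Suc i)) + t (Top (Suc i)) + right_detour t n (Suc i))"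
  by (subst right_detour.simps) auto

lemma right_detour_nonneg:
  assumes "\<And>e. 0 \<le> t e"
  shows "0 \<le> right_detour t n i"
  using assms
proof (induction t n i rule: right_detour.induct)
  case (1 t n i)
  show ?case
    using "1.IH" "1.prems" by (subst right_detour.simps) (auto intro: add_nonneg_nonneg)
qed

definition ladder_dist :: "(ladder_edge \<Rightarrow> real) \<Rightarrow> nat \<Rightarrow> nat \<times> nat \<Rightarrow> real" where
  "ladder_dist t n = (\<lambda>(i, j). let a = fst (front t i); b = snd (front t i); r = right_detour t n i
     in if j = 0 then min a (b + r) else min b (a + r))"

lemma ladder_dist_rung:
  assumes "\<And>e. 0 \<le> t e" "i \<le> n"
  shows "\<bar>ladder_dist t n (i, 0) - ladder_dist t n (i, 1)\<bar> \<le> t (Rung i)"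
  using right_detour_le[of t n i] right_detour_nonneg[of t n i] assms(1)
  by (simp add: ladder_dist_def Let_def)

lemma ladder_dist_horizontal:
  assumes "\<And>e. 0 \<le> t e" "i < n"
  shows "\<bar>ladder_dist t n (i, 0) - ladder_dist t n (Suc i, 0)\<bar> \<le> t (Bot (Suc i))"
    and "\<bar>ladder_dist t n (i, 1) - ladder_dist t n (Suc i, 1)\<bar> \<le> t (Top (Suc i))"
proof -
  have g: "\<bar>snd (front t i) - fst (front t i)\<bar> \<le> t (Rung i)"
    using front_gap assms by blast
  let ?a = "fst (front t i)" and ?b = "snd (front t i)" and ?r = "right_detour t n (Suc i)"
  let ?X = "t (Bot (Suc i))" and ?Y = "t (Top (Suc i))" and ?Z = "t (Rung (Suc i))"
  have r: "0 \<le> ?r" "?r \<le> ?Z" "0 \<le> ?X" "0 \<le> ?Y"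
    using right_detour_le right_detour_nonneg assms(1) by auto
  \<comment> \<open>The alternative through rung \<open>i\<close> drops out of the detour: by
    \<open>g\<close> the front entries already differ by at most its weight.\<close>
  have "ladder_dist t n (i, 0) = min ?a (?b + ?X + ?Y + ?r)"
    "ladder_dist t n (i, 1) = min ?b (?a + ?X + ?Y + ?r)"
    using g by (simp_all add: ladder_dist_def Let_def right_detour_step[OF assms(2)])
  moreover have "ladder_dist t n (Suc i, 0) = min (?a + ?X) (?b + ?Y + ?r)"
    "ladder_dist t n (Suc i, 1) = min (?b + ?Y) (?a + ?X + ?r)"
    using r by (simp_all add: ladder_dist_def Let_def fst_front_Suc snd_front_Suc del: front.simps)
  \<comment> \<open>On each rail both minima range over the same two routes, and corresponding
    entries differ by exactly the weight of the edge in question.\<close>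
  ultimately show "\<bar>ladder_dist t n (i, 0) - ladder_dist t n (Suc i, 0)\<bar> \<le> ?X"
    and "\<bar>ladder_dist t n (i, 1) - ladder_dist t n (Suc i, 1)\<bar> \<le> ?Y"
    using r by auto
qed

text \<open>This is the Lipschitz property of a potential function: telescoping it along any path
  bounds the weight of that path from below, wherever the path goes in between.\<close>

lemma ladder_dist_edge:
  assumes "\<And>e. 0 \<le> t e" "e \<in> ladder_edges n" "ends e = {u, v}"
  shows "ladder_dist t n v \<le> ladder_dist t n u + t e"
proof (cases e)
  case (Bot k)
  then obtain i where "k = Suc i" "i < n"
    using assms(2) by (cases k) (auto simp: ladder_edges_def)
  then show ?thesis
    using assms(3) Bot ladder_dist_horizontal(1)[where t = t and i = i and n = n, OF assms(1)]
    by (auto simp: doubleton_eq_iff)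
next
  case (Top k)
  then obtain i where "k = Suc i" "i < n"
    using assms(2) by (cases k) (auto simp: ladder_edges_def)
  then show ?thesis
    using assms(3) Top ladder_dist_horizontal(2)[where t = t and i = i and n = n, OF assms(1)]
    by (auto simp: doubleton_eq_iff)
next
  case (Rung i)
  then have "i \<le> n"
    using assms(2) by (auto simp: ladder_edges_def)
  then show ?thesis
    using assms(3) Rung ladder_dist_rung[where t = t and i = i and n = n, OF assms(1)]
    by (auto simp: doubleton_eq_iff)
qed

section \<open>Paths in the ladder and their weights\<close>

definition ladder_route :: "nat \<Rightarrow> nat \<times> nat \<Rightarrow> (nat \<times> nat) list \<Rightarrow> bool" where
  "ladder_route n v vs \<longleftrightarrow> vs \<noteq> [] \<and> distinct vs \<and> hd vs = (0, 0) \<and> last vs = v \<and>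
     (\<forall>i. Suc i < length vs \<longrightarrow> (\<exists>e\<in>ladder_edges n. ends e = {vs ! i, vs ! Suc i}))"

lemma is_ladder_path_route: "is_ladder_path n vs \<longleftrightarrow> ladder_route n (n, 0) vs"
  by (simp add: is_ladder_path_def ladder_route_def)

text \<open>Confining routes to a finite grid serves twice: it makes the set of paths finite, so
  that \<open>Min\<close> is a true minimum, and it shows that the vertices of the next column are
  fresh.\<close>

lemma ladder_route_vertices:
  assumes "ladder_route n v vs"
  shows "set vs \<subseteq> {..n} \<times> {..1}"
proof
  fix u assume "u \<in> set vs"
  then obtain i where i: "i < length vs" "vs ! i = u"
    by (auto simp: in_set_conv_nth)
  show "u \<in> {..n} \<times> {..1}"
  proof (cases i)
    case 0
    then show ?thesis
      using i assms by (auto simp: ladder_route_def hd_conv_nth)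
  next
    case (Suc j)
    then obtain e where e: "e \<in> ladder_edges n" "ends e = {vs ! j, u}"
      using i assms by (auto simp: ladder_route_def)
    then have "u \<in> ends e"
      by simp
    with e(1) show ?thesis
      by (cases e) (auto simp: ladder_edges_def)
  qed
qed

lemma finite_ladder_paths: "finite {vs. is_ladder_path n vs}"
proof (rule finite_subset)
  show "{vs. is_ladder_path n vs} \<subseteq> {vs. set vs \<subseteq> {..n} \<times> {..1} \<and> distinct vs}"
    using ladder_route_vertices by (auto simp: is_ladder_path_route ladder_route_def)
qed (intro finite_subset_distinct finite_cartesian_product finite_atMost)

lemma path_weight_append:
  "vs \<noteq> [] \<Longrightarrow> path_weight t n (vs @ [v]) = path_weight t n vs + t (edge_between n (last vs) v)"
proof -
  assume "vs \<noteq> []"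
  then obtain k where k: "length vs = Suc k"
    by (cases vs) auto
  have "(\<Sum>i<k. t (edge_between n ((vs @ [v]) ! i) ((vs @ [v]) ! Suc i)))
      = (\<Sum>i<k. t (edge_between n (vs ! i) (vs ! Suc i)))"
    by (intro sum.cong) (auto simp: nth_append k)
  then show ?thesis
    using \<open>vs \<noteq> []\<close> by (simp add: path_weight_def k nth_append last_conv_nth)
qed

lemma ladder_route_append:
  assumes "ladder_route n u vs" "e \<in> ladder_edges n" "ends e = {u, v}" "v \<notin> set vs"
  shows "ladder_route n v (vs @ [v])"
    and "path_weight t n (vs @ [v]) = path_weight t n vs + t e"
proof -
  show "ladder_route n v (vs @ [v])"
    unfolding ladder_route_def
  proof (intro conjI allI impI)
    fix i assume "Suc i < length (vs @ [v])"
    then consider "Suc i < length vs" | "Suc i = length vs"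
      by fastforce
    then show "\<exists>e\<in>ladder_edges n. ends e = {(vs @ [v]) ! i, (vs @ [v]) ! Suc i}"
    proof cases
      case 1
      then show ?thesis
        using assms(1) by (auto simp: ladder_route_def nth_append)
    next
      case 2
      then have "vs ! i = u"
        using assms(1) by (auto simp: ladder_route_def last_conv_nth dest!: sym[of _ "length vs"])
      then show ?thesis
        using 2 assms(2,3) by (auto simp: nth_append)
    qed
  qed (use assms in \<open>auto simp: ladder_route_def\<close>)
  show "path_weight t n (vs @ [v]) = path_weight t n vs + t e"
    using assms by (simp add: path_weight_append ladder_route_def edge_between_eq)
qed

text \<open>The weight needs an argument because \<open>edge_between\<close> is described relative
  to the edge set of the current ladder; the chosen edge must be seen to stay the same in the larger
  one.\<close>

lemma ladder_route_Suc:
  assumes "ladder_route n v vs"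
  shows "ladder_route (Suc n) v vs" and "path_weight t (Suc n) vs = path_weight t n vs"
proof -
  have mono: "e \<in> ladder_edges (Suc n)" if "e \<in> ladder_edges n" for e
    using that by (auto simp: ladder_edges_def)
  then show "ladder_route (Suc n) v vs"
    using assms unfolding ladder_route_def by blast
  show "path_weight t (Suc n) vs = path_weight t n vs"
    unfolding path_weight_def
  proof (intro sum.cong refl)
    fix i assume "i \<in> {..<length vs - 1}"
    then have "Suc i < length vs"
      by auto
    then obtain e where e: "e \<in> ladder_edges n" "ends e = {vs ! i, vs ! Suc i}"
      using assms by (auto simp: ladder_route_def)
    show "t (edge_between (Suc n) (vs ! i) (vs ! Suc i)) = t (edge_between n (vs ! i) (vs ! Suc i))"
      using edge_between_eq[OF e] edge_between_eq[OF mono[OF e(1)] e(2)] by simp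
  qed
qed

text \<open>Both ends are carried through the induction, since a new optimal route may extend either
  of the two old ones, with or without the new rung as its last edge.\<close>

lemma ladder_routes_front:
  "(\<exists>vs. ladder_route n (n, 0) vs \<and> path_weight t n vs = fst (front t n)) \<and>
   (\<exists>vs. ladder_route n (n, 1) vs \<and> path_weight t n vs = snd (front t n))"
proof (induction n)
  case 0
  have r: "ladder_route 0 (0, 0) [(0, 0)]" and w: "path_weight t 0 [(0, 0)] = 0"
    by (auto simp: ladder_route_def path_weight_def)
  have "Rung 0 \<in> ladder_edges 0" "ends (Rung 0) = {(0, 0), (0, 1)}"
    by (auto simp: ladder_edges_def)
  from ladder_route_append(1)[OF r this] ladder_route_append(2)[where t = t, OF r this] r w show ?case
    by force
next
  case (Suc n)
  let ?X = "t (Bot (Suc n))" and ?Y = "t (Top (Suc n))" and ?Z = "t (Rung (Suc n))"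
  obtain vs0 vs1 where vs0: "ladder_route n (n, 0) vs0" "path_weight t n vs0 = fst (front t n)"
    and vs1: "ladder_route n (n, 1) vs1" "path_weight t n vs1 = snd (front t n)"
    using Suc by blast
  note new0 = ladder_route_vertices[OF vs0(1)] and new1 = ladder_route_vertices[OF vs1(1)]
  note s0 = ladder_route_Suc[OF vs0(1)] and s1 = ladder_route_Suc[OF vs1(1)]
  have edges: "Bot (Suc n) \<in> ladder_edges (Suc n)" "Top (Suc n) \<in> ladder_edges (Suc n)"
    "Rung (Suc n) \<in> ladder_edges (Suc n)"
    by (auto simp: ladder_edges_def)
  have e: "ends (Bot (Suc n)) = {(n, 0), (Suc n, 0)}" "ends (Top (Suc n)) = {(n, 1), (Suc n, 1)}"
    "ends (Rung (Suc n)) = {(Suc n, 0), (Suc n, 1)}" "ends (Rung (Suc n)) = {(Suc n, 1), (Suc n, 0)}"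
    by auto
  have "(Suc n, 0) \<notin> set vs0" "(Suc n, 1) \<notin> set (vs0 @ [(Suc n, 0)])"
    "(Suc n, 1) \<notin> set vs1" "(Suc n, 0) \<notin> set (vs1 @ [(Suc n, 1)])"
    using new0 new1 by auto
  note new = this
  note p0 = ladder_route_append[OF s0(1) edges(1) e(1) new(1)]
  note p1 = ladder_route_append[OF s1(1) edges(2) e(2) new(3)]
  note q0 = ladder_route_append[OF p0(1) edges(3) e(3) new(2)]
  note q1 = ladder_route_append[OF p1(1) edges(3) e(4) new(4)]
  show ?case
  proof (intro conjI)
    show "\<exists>vs. ladder_route (Suc n) (Suc n, 0) vs \<and> path_weight t (Suc n) vs = fst (front t (Suc n))"
    proof (cases "fst (front t n) + ?X \<le> snd (front t n) + ?Y + ?Z")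
      case True
      then show ?thesis
        using p0(1) p0(2)[of t] s0(2)[of t] vs0(2) by (auto simp: fst_front_Suc simp del: front.simps)
    next
      case False
      then show ?thesis
        using q1(1) q1(2)[of t] p1(2)[of t] s1(2)[of t] vs1(2)
        by (auto simp: fst_front_Suc simp del: front.simps)
    qed
    show "\<exists>vs. ladder_route (Suc n) (Suc n, 1) vs \<and> path_weight t (Suc n) vs = snd (front t (Suc n))"
    proof (cases "snd (front t n) + ?Y \<le> fst (front t n) + ?X + ?Z")
      case True
      then show ?thesis
        using p1(1) p1(2)[of t] s1(2)[of t] vs1(2) by (auto simp: snd_front_Suc simp del: front.simps)
    next
      case False
      then show ?thesis
        using q0(1) q0(2)[of t] p0(2)[of t] s0(2)[of t] vs0(2)
        by (auto simp: snd_front_Suc simp del: front.simps)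
    qed
  qed
qed

lemma ladder_dist_path:
  assumes t: "\<And>e. 0 \<le> t e" and r: "ladder_route n v vs"
  shows "ladder_dist t n v \<le> path_weight t n vs"
proof -
  have "ladder_dist t n (vs ! k) \<le> ladder_dist t n (vs ! 0) +
      (\<Sum>i<k. t (edge_between n (vs ! i) (vs ! Suc i)))" if "k < length vs" for k
    using that
  proof (induction k)
    case (Suc k)
    then obtain e where e: "e \<in> ladder_edges n" "ends e = {vs ! k, vs ! Suc k}"
      using r by (auto simp: ladder_route_def)
    show ?case
      using Suc ladder_dist_edge[where t = t, OF t e] edge_between_eq[OF e] by auto
  qed simp
  from this[of "length vs - 1"] have "ladder_dist t n v \<le> ladder_dist t n (0, 0) + path_weight t n vs"
    using r by (auto simp: ladder_route_def path_weight_def last_conv_nth hd_conv_nth)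
  moreover have "ladder_dist t n (0, 0) \<le> 0"
    by (simp add: ladder_dist_def)
  ultimately show ?thesis
    by simp
qed

lemma passage_time_eq_front:
  assumes t: "\<And>e. 0 \<le> t e"
  shows "passage_time t n = fst (front t n)"
  unfolding passage_time_def
proof (rule Min_eqI)
  show "finite (path_weight t n ` {vs. is_ladder_path n vs})"
    by (intro finite_imageI finite_ladder_paths)
  show "fst (front t n) \<in> path_weight t n ` {vs. is_ladder_path n vs}"
    using ladder_routes_front[of n t] by (auto simp: is_ladder_path_route image_iff)
  fix y assume "y \<in> path_weight t n ` {vs. is_ladder_path n vs}"
  then have "ladder_dist t n (n, 0) \<le> y"
    using ladder_dist_path[where t = t, OF t] by (auto simp: is_ladder_path_route)
  \<comment> \<open>In the last column the only detour is the rung itself, and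
    \<open>front_gap\<close> shows that it brings no gain over the front entry.\<close>
  moreover have "ladder_dist t n (n, 0) = fst (front t n)"
    using front_gap[where t = t and n = n, OF t] by (simp add: ladder_dist_def right_detour_end)
  ultimately show "fst (front t n) \<le> y"
    by simp
qed

section \<open>Bessel series at 2 and the corrector\<close>

text \<open>At argument 2 all powers of \<open>x / 2\<close> equal 1, so only the factorials
  remain.\<close>

definition besselJ_term :: "nat \<Rightarrow> nat \<Rightarrow> real" where
  "besselJ_term \<nu> k = (-1) ^ k / (fact k * fact (k + \<nu>))"

lemma summable_inverse_fact_prod:
  "summable (\<lambda>k. 1 / (fact (k + i) * fact (k + j)) :: real)"
proof (rule summable_comparison_test')
  show "summable (\<lambda>k. inverse (fact (k + i)) :: real)"
    using summable_ignore_initial_segment[OF summable_exp[of "1::real"], of i] by simp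
  have "1 \<le> (fact (k + j) :: real)" for k
    by (rule fact_ge_1)
  then show "norm (1 / (fact (k + i) * fact (k + j)) :: real) \<le> inverse (fact (k + i))" for k
    by (simp add: divide_simps)
qed

lemma besselJ_term_summable: "summable (besselJ_term \<nu>)"
proof (rule summable_comparison_test')
  show "summable (\<lambda>k. 1 / (fact (k + 0) * fact (k + \<nu>)) :: real)"
    by (rule summable_inverse_fact_prod)
qed (simp add: besselJ_term_def)

lemma besselJ_2: "besselJ \<nu> 2 = (\<Sum>k. besselJ_term \<nu> k)"
  by (simp add: besselJ_def besselJ_term_def)

text \<open>Shifting the series of order 1 by one index aligns the factor
  \<open>fact (k + 2)\<close> in both terms on the left.\<close>

lemma besselJ_term_recurrence:
  "besselJ_term 1 (Suc k) - besselJ_term 2 k = besselJ_term 0 (Suc k)"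
  by (simp add: besselJ_term_def divide_simps) (simp add: algebra_simps)

text \<open>The case \<open>z = 2\<close>, \<open>\<nu> = 1\<close> of $J_{\nu-1}(z) + J_{\nu+1}(z) = (2\nu/z)\, J_\nu(z)$.\<close>

lemma besselJ_2_0: "besselJ 0 2 = besselJ 1 2 - besselJ 2 2"
proof -
  have "besselJ 1 2 = besselJ_term 1 0 + (\<Sum>k. besselJ_term 1 (Suc k))"
    "besselJ 0 2 = besselJ_term 0 0 + (\<Sum>k. besselJ_term 0 (Suc k))"
    unfolding besselJ_2 by (auto simp: suminf_split_head[OF besselJ_term_summable])
  moreover have "(\<Sum>k. besselJ_term 0 (Suc k)) = (\<Sum>k. besselJ_term 1 (Suc k)) - besselJ 2 2"
    unfolding besselJ_2 besselJ_term_recurrence[symmetric]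
    by (intro suminf_diff[symmetric]) (auto simp: besselJ_term_summable summable_Suc_iff)
  ultimately show ?thesis
    by (simp add: besselJ_term_def)
qed

text \<open>The leading term is 1/2. Since (k+1)! >= 2^k and (k+3)! >= 6, the remaining terms are
  bounded in modulus by a geometric series with sum 1/3.\<close>

lemma besselJ_2_2_pos: "0 < besselJ 2 2"
proof -
  have "(\<lambda>k. besselJ_term 2 (k + 1)) sums (besselJ 2 2 - (\<Sum>k<1. besselJ_term 2 k))"
    unfolding besselJ_2 by (intro sums_split_initial_segment summable_sums besselJ_term_summable)
  then have tail: "(\<lambda>k. besselJ_term 2 (k + 1)) sums (besselJ 2 2 - 1 / 2)"
    by (simp add: besselJ_term_def)
  have geom: "(\<lambda>k. - 1 / 6 * (1 / 2) ^ k) sums (- 1 / 6 * 2 :: real)"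
    using geometric_sums[of "1 / 2 :: real"] by (intro sums_mult) simp
  have "- 1 / 6 * (1 / 2) ^ k \<le> besselJ_term 2 (k + 1)" for k
  proof -
    have "(2::real) ^ k \<le> fact (k + 1)"
      by (induction k) (auto intro!: mult_mono)
    moreover have "(6::real) \<le> fact (k + 3)"
      using fact_mono[of 3 "k + 3", where 'a = real] by (simp add: eval_nat_numeral)
    ultimately have "2 ^ k * 6 \<le> (fact (k + 1) * fact (k + 3) :: real)"
      by (intro mult_mono) auto
    then have "1 / (fact (k + 1) * fact (k + 3)) \<le> (1 / (2 ^ k * 6) :: real)"
      by (intro divide_left_mono) auto
    moreover have "\<bar>besselJ_term 2 (k + 1)\<bar> = 1 / (fact (k + 1) * fact (k + 3))"
      by (simp add: besselJ_term_def abs_mult numeral_3_eq_3)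
    ultimately show ?thesis
      by (simp add: power_divide abs_le_iff mult.commute)
  qed
  from sums_le[OF this geom tail] show ?thesis
    by simp
qed

section \<open>The power series solving the Poisson equation\<close>

definition corrector_coeff :: "nat \<Rightarrow> real" where
  "corrector_coeff k = - ((-1) ^ k / (fact (k + 1) * fact (k + 2))) / (2 * besselJ 2 2)"

text \<open>For x > 0 this is (J_1(2 sqrt x)/sqrt x - 1)/(2 J_2(2)). A corrector is determined only
  up to an additive constant; this one vanishes at x = 0.\<close>

definition corrector :: "real \<Rightarrow> real" where
  "corrector x = (\<Sum>k. corrector_coeff k * x ^ (k + 1))"

lemma corrector_coeff_summable: "summable (\<lambda>k. \<bar>corrector_coeff k\<bar>)"
proof -
  have "\<bar>corrector_coeff k\<bar> = 1 / (fact (k + 1) * fact (k + 2)) * (1 / (2 * besselJ 2 2))" for k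
    using besselJ_2_2_pos unfolding corrector_coeff_def
    by (simp only: abs_divide abs_minus_cancel abs_mult power_abs) (simp add: divide_simps)
  then show ?thesis
    by (simp only: summable_inverse_fact_prod summable_mult2)
qed

lemma corrector_summable:
  assumes "\<bar>x\<bar> \<le> 1"
  shows "summable (\<lambda>k. \<bar>corrector_coeff k * x ^ (k + 1)\<bar>)"
    "summable (\<lambda>k. corrector_coeff k * x ^ (k + 1))"
proof -
  have "norm (\<bar>corrector_coeff k * x ^ (k + 1)\<bar>) \<le> \<bar>corrector_coeff k\<bar>" for k
    using power_le_one[of "\<bar>x\<bar>" "k + 1"] assms
    by (simp add: abs_mult power_abs mult_left_le del: power_Suc)
  then show "summable (\<lambda>k. \<bar>corrector_coeff k * x ^ (k + 1)\<bar>)"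
    by (intro summable_comparison_test'[OF corrector_coeff_summable])
  then show "summable (\<lambda>k. corrector_coeff k * x ^ (k + 1))"
    by (rule summable_rabs_cancel)
qed

lemma corrector_bounded:
  assumes "\<bar>x\<bar> \<le> 1"
  shows "\<bar>corrector x\<bar> \<le> (\<Sum>k. \<bar>corrector_coeff k\<bar>)"
proof -
  have "\<bar>corrector x\<bar> \<le> (\<Sum>k. \<bar>corrector_coeff k * x ^ (k + 1)\<bar>)"
    unfolding corrector_def by (rule summable_rabs[OF corrector_summable(1)[OF assms]])
  also have "\<dots> \<le> (\<Sum>k. \<bar>corrector_coeff k\<bar>)"
  proof (intro suminf_le corrector_coeff_summable corrector_summable(1) assms)
    show "\<bar>corrector_coeff k * x ^ (k + 1)\<bar> \<le> \<bar>corrector_coeff k\<bar>" for k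
      using power_le_one[of "\<bar>x\<bar>" "k + 1"] assms
      by (simp add: abs_mult power_abs mult_left_le del: power_Suc)
  qed
  finally show ?thesis .
qed

lemma corrector_measurable [measurable]: "corrector \<in> borel_measurable borel"
  unfolding corrector_def by measurable

text \<open>Through this recursion the degree-raising part of one step reproduces the series from
  its second term on.\<close>

lemma corrector_coeff_Suc:
  "corrector_coeff (Suc k) = - corrector_coeff k / ((real k + 2) * (real k + 3))"
  unfolding corrector_coeff_def by (simp add: divide_simps algebra_simps)

text \<open>
  The Poisson equation in the variable \<open>x = exp (- u)\<close>: the \<open>k\<close>-th factor is the expectation of
  \<open>exp (- (k + 1) * u')\<close> after one step from \<open>u\<close>.
\<close>

lemma poisson_series:
  assumes "\<bar>x\<bar> \<le> 1"
  shows "(\<lambda>k. corrector_coeff k * (1 / (real k + 2) + x / (real k + 3) - x ^ (k + 2) / ((real k + 2) * (real k + 3))))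
    sums (1 / 2 - besselJ 1 2 / (2 * besselJ 2 2) + x / 2 + corrector x)"
proof -
  let ?J = "besselJ 2 2"
  have J: "?J > 0" by (rule besselJ_2_2_pos)
  \<comment> \<open>Constant part: the two omitted terms of the series for J_0(2) are 1 and -1 and
    cancel, so the full value J_0(2) appears.\<close>
  have "(\<lambda>k. besselJ_term 0 (k + 2)) sums (besselJ 0 2 - (\<Sum>k<2. besselJ_term 0 k))"
    unfolding besselJ_2 by (intro sums_split_initial_segment summable_sums besselJ_term_summable)
  then have "(\<lambda>k. - 1 / (2 * ?J) * besselJ_term 0 (k + 2)) sums (- 1 / (2 * ?J) * besselJ 0 2)"
    by (intro sums_mult) (simp add: besselJ_term_def numeral_2_eq_2)
  moreover have "- 1 / (2 * ?J) * besselJ_term 0 (k + 2) = corrector_coeff k * (1 / (real k + 2))" for k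
    using J unfolding besselJ_term_def corrector_coeff_def by (simp add: divide_simps algebra_simps)
  ultimately have A: "(\<lambda>k. corrector_coeff k * (1 / (real k + 2))) sums (- 1 / (2 * ?J) * besselJ 0 2)"
    by (simp only:)
  \<comment> \<open>Linear part: here the omitted leading term of J_2(2) is 1/2, and it
    survives.\<close>
  have "(\<lambda>k. besselJ_term 2 (k + 1)) sums (?J - (\<Sum>k<1. besselJ_term 2 k))"
    unfolding besselJ_2 by (intro sums_split_initial_segment summable_sums besselJ_term_summable)
  then have "(\<lambda>k. 1 / (2 * ?J) * besselJ_term 2 (k + 1)) sums (1 / (2 * ?J) * (?J - 1 / 2))"
    by (intro sums_mult) (simp add: besselJ_term_def)
  moreover have "1 / (2 * ?J) * besselJ_term 2 (k + 1) = corrector_coeff k * (1 / (real k + 3))" for k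
    using J unfolding besselJ_term_def corrector_coeff_def
    by (simp add: divide_simps eval_nat_numeral)
  ultimately have "(\<lambda>k. corrector_coeff k * (1 / (real k + 3))) sums (1 / (2 * ?J) * (?J - 1 / 2))"
    by (simp only:)
  from sums_mult[OF this, of x]
  have B: "(\<lambda>k. corrector_coeff k * (x / (real k + 3))) sums (x * (1 / (2 * ?J) * (?J - 1 / 2)))"
    by (simp add: algebra_simps)
  \<comment> \<open>Degrees from 2 on: the series without its linear term, which is
    \<open>- x / (4 * ?J)\<close>.\<close>
  have "(\<lambda>k. corrector_coeff k * x ^ (k + 1)) sums corrector x"
    unfolding corrector_def by (intro summable_sums corrector_summable assms)
  then have "(\<lambda>k. corrector_coeff (k + 1) * x ^ (k + 1 + 1)) sums
      (corrector x - (\<Sum>k<1. corrector_coeff k * x ^ (k + 1)))"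
    by (rule sums_split_initial_segment)
  moreover have "corrector_coeff (k + 1) * x ^ (k + 1 + 1) =
      - corrector_coeff k * (x ^ (k + 2) / ((real k + 2) * (real k + 3)))" for k
    using corrector_coeff_Suc[of k] by (simp add: algebra_simps)
  moreover have "corrector x - (\<Sum>k<1. corrector_coeff k * x ^ (k + 1)) = corrector x + x / (4 * ?J)"
    by (simp add: corrector_coeff_def)
  ultimately have C: "(\<lambda>k. - corrector_coeff k * (x ^ (k + 2) / ((real k + 2) * (real k + 3)))) sums
      (corrector x + x / (4 * ?J))"
    by (simp only:)
  have "corrector_coeff k * (1 / (real k + 2)) + corrector_coeff k * (x / (real k + 3)) +
      - corrector_coeff k * (x ^ (k + 2) / ((real k + 2) * (real k + 3))) =
      corrector_coeff k * (1 / (real k + 2) + x / (real k + 3) - x ^ (k + 2) / ((real k + 2) * (real k + 3)))" for k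
    by (simp add: algebra_simps)
  \<comment> \<open>The normalisation takes effect here: the 1/2 left over in the linear part
    contributes \<open>- x / (4 * ?J)\<close>, which cancels the correction from the higher degrees
    and leaves exactly \<open>x / 2\<close>.\<close>
  moreover have "- 1 / (2 * ?J) * besselJ 0 2 + x * (1 / (2 * ?J) * (?J - 1 / 2)) + (corrector x + x / (4 * ?J)) =
      1 / 2 - besselJ 1 2 / (2 * besselJ 2 2) + x / 2 + corrector x"
    using J unfolding besselJ_2_0 by (simp add: field_simps)
  ultimately show ?thesis
    using sums_add[OF sums_add[OF A B] C] by (simp only:)
qed

section \<open>Integrals against exponential weights\<close>

abbreviation std_exp :: "real measure" where
  "std_exp \<equiv> density lborel (\<lambda>x. ennreal (exponential_density 1 x))"

lemma prob_space_std_exp: "prob_space std_exp"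
  by (rule prob_space_exponential_density) simp

lemma nn_integral_std_exp:
  assumes [measurable]: "f \<in> borel_measurable borel"
  shows "(\<integral>\<^sup>+x. f x \<partial>std_exp) = (\<integral>\<^sup>+x. ennreal (exp (- x)) * f x * indicator {0..} x \<partial>lborel)"
  by (subst nn_integral_density)
     (auto simp: exponential_density_def intro!: nn_integral_cong split: split_indicator)

lemma AE_std_exp_nonneg: "AE x in std_exp. 0 \<le> x"
  by (simp add: AE_density exponential_density_def)

text \<open>The integrands in use are nonnegative with at most one kink, at \<open>c\<close>.
  \<open>F1\<close> and \<open>F2\<close> are antiderivatives of the two branches times the density,
  and by nonnegativity the finite value also establishes integrability.\<close>

lemma has_bochner_integral_std_exp_split:
  fixes f f1 f2 F1 F2 :: "real \<Rightarrow> real"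
  assumes c: "0 \<le> c"
    and [measurable]: "f \<in> borel_measurable borel" "f1 \<in> borel_measurable borel" "f2 \<in> borel_measurable borel"
    and f1: "\<And>x. 0 \<le> x \<Longrightarrow> x \<le> c \<Longrightarrow> f x = f1 x"
    and f2: "\<And>x. c \<le> x \<Longrightarrow> f x = f2 x"
    and nonneg: "\<And>x. 0 \<le> x \<Longrightarrow> 0 \<le> f x"
    and F1: "\<And>x. (F1 has_real_derivative f1 x * exp (- x)) (at x)"
    and F2: "\<And>x. (F2 has_real_derivative f2 x * exp (- x)) (at x)"
    and lim: "(F2 \<longlongrightarrow> L) at_top"
  shows "has_bochner_integral std_exp f (L - F2 c + (F1 c - F1 0))"
proof (rule has_bochner_integral_nn_integral)
  show "f \<in> borel_measurable std_exp"
    by simp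
  show "AE x in std_exp. 0 \<le> f x"
    using AE_std_exp_nonneg by eventually_elim (rule nonneg)
  have f1_nonneg: "0 \<le> f1 x" if "0 \<le> x" "x \<le> c" for x
    using f1[OF that] nonneg[OF that(1)] by simp
  have f2_nonneg: "0 \<le> f2 x" if "c \<le> x" for x
    using f2[OF that] nonneg[of x] c that by simp
  have i1: "(\<integral>\<^sup>+x. ennreal (f1 x * exp (- x)) * indicator {0..c} x \<partial>lborel) = F1 c - F1 0"
    using c f1_nonneg F1 by (intro nn_integral_FTC_Icc) auto
  have i2: "(\<integral>\<^sup>+x. ennreal (f2 x * exp (- x)) * indicator {c..} x \<partial>lborel) = L - F2 c"
    using f2_nonneg F2 lim by (intro nn_integral_FTC_atLeast) auto
  have m1: "F1 0 \<le> F1 c"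
  proof (rule DERIV_nonneg_imp_nondecreasing[OF c])
    fix y assume "0 \<le> y" "y \<le> c"
    then have "0 \<le> f1 y * exp (- y)"
      by (simp add: f1_nonneg)
    with F1[of y] show "\<exists>D. (F1 has_real_derivative D) (at y) \<and> 0 \<le> D"
      by blast
  qed
  have "F2 c \<le> F2 x" if "c \<le> x" for x
  proof (rule DERIV_nonneg_imp_nondecreasing[OF that])
    fix y assume "c \<le> y"
    then have "0 \<le> f2 y * exp (- y)"
      by (simp add: f2_nonneg)
    with F2[of y] show "\<exists>D. (F2 has_real_derivative D) (at y) \<and> 0 \<le> D"
      by blast
  qed
  then have m2: "F2 c \<le> L"
    by (intro tendsto_lowerbound[OF lim] eventually_at_top_linorderI) auto
  show "0 \<le> L - F2 c + (F1 c - F1 0)"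
    using m1 m2 by simp
  have "(\<integral>\<^sup>+x. ennreal (f x) \<partial>std_exp) =
      (\<integral>\<^sup>+x. ennreal (f2 x * exp (- x)) * indicator {c..} x +
        ennreal (f1 x * exp (- x)) * indicator {0..c} x \<partial>lborel)"
    unfolding nn_integral_std_exp[OF measurable_compose[OF assms(2) measurable_ennreal]]
  proof (rule nn_integral_cong_AE)
    \<comment> \<open>The two indicators overlap at \<open>c\<close>, so the identity may fail at
      that one point.\<close>
    show "AE x in lborel. ennreal (exp (- x)) * ennreal (f x) * indicator {0..} x =
        ennreal (f2 x * exp (- x)) * indicator {c..} x + ennreal (f1 x * exp (- x)) * indicator {0..c} x"
      using AE_lborel_singleton[of c]
    proof eventually_elim
      case (elim x)
      then show ?case
        using c f1[of x] f2[of x] nonneg[of x]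
        by (auto simp: ennreal_mult' mult.commute split: split_indicator)
    qed
  qed
  also have "\<dots> = ennreal (L - F2 c + (F1 c - F1 0))"
    using m1 m2 by (subst nn_integral_add) (auto simp: i1 i2 simp flip: ennreal_plus)
  finally show "(\<integral>\<^sup>+x. ennreal (f x) \<partial>std_exp) = ennreal (L - F2 c + (F1 c - F1 0))" .
qed

lemma has_real_derivative_exp_scaled:
  fixes a C x :: real
  assumes "a \<noteq> 0"
  shows "((\<lambda>x. C * exp (a * x) / a) has_real_derivative C * exp (a * x)) (at x)"
  using assms by (auto intro!: derivative_eq_intros)

lemma std_exp_laplace_min:
  fixes m v :: real
  assumes "0 < m" "0 \<le> v"
  shows "has_bochner_integral std_exp (\<lambda>z. exp (- m * min v z))
    (1 / (m + 1) + m / (m + 1) * exp (- (m + 1) * v))"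
proof -
  define F1 where "F1 = (\<lambda>z. 1 * exp ((- m - 1) * z) / (- m - 1))"
  define F2 where "F2 = (\<lambda>z. exp (- m * v) * exp ((- 1) * z) / (- 1))"
  have "has_bochner_integral std_exp (\<lambda>z. exp (- m * min v z)) (0 - F2 v + (F1 v - F1 0))"
  proof (rule has_bochner_integral_std_exp_split[where ?f1.0 = "\<lambda>z. exp (- m * z)" and ?f2.0 = "\<lambda>z. exp (- m * v)"])
    have eq: "exp (- m * x) * exp (- x) = 1 * exp ((- m - 1) * x)" for x
      by (simp add: algebra_simps flip: exp_add)
    show "(F1 has_real_derivative exp (- m * x) * exp (- x)) (at x)" for x
      unfolding eq F1_def using assms by (intro has_real_derivative_exp_scaled) simp
    have eq: "exp (- m * v) * exp (- x) = exp (- m * v) * exp ((- 1) * x)" for x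
      by simp
    show "(F2 has_real_derivative exp (- m * v) * exp (- x)) (at x)" for x
      unfolding eq F2_def by (intro has_real_derivative_exp_scaled) simp
    show "(F2 \<longlongrightarrow> 0) at_top"
      unfolding F2_def by real_asymp
  qed (use assms in auto)
  also have "F2 v = - exp ((- m - 1) * v)"
    by (simp add: F2_def algebra_simps flip: exp_add)
  also have "0 - - exp ((- m - 1) * v) + (F1 v - F1 0) = 1 / (m + 1) + m / (m + 1) * exp (- (m + 1) * v)"
    using assms unfolding F1_def by (simp add: divide_simps) (simp add: algebra_simps)
  finally show ?thesis .
qed

text \<open>Below \<open>c\<close> the integrand times the density is a multiple of
  \<open>exp ((k - 1) * x)\<close>, which degenerates at k = 1. The lemma is applied with
  \<open>k = m + 1\<close>, the rate that integrating out the rung weight leaves behind.\<close>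

lemma std_exp_laplace_dist:
  fixes k c :: real
  assumes "1 < k" "0 \<le> c"
  shows "has_bochner_integral std_exp (\<lambda>x. exp (- k * \<bar>c - x\<bar>))
    ((2 * k * exp (- c) - (k + 1) * exp (- k * c)) / (k\<^sup>2 - 1))"
proof -
  define F1 where "F1 = (\<lambda>x. exp (- k * c) * exp ((k - 1) * x) / (k - 1))"
  define F2 where "F2 = (\<lambda>x. exp (k * c) * exp ((- k - 1) * x) / (- k - 1))"
  have "has_bochner_integral std_exp (\<lambda>x. exp (- k * \<bar>c - x\<bar>)) (0 - F2 c + (F1 c - F1 0))"
  proof (rule has_bochner_integral_std_exp_split[where ?f1.0 = "\<lambda>x. exp (- k * (c - x))"
        and ?f2.0 = "\<lambda>x. exp (- k * (x - c))"])
    have eq: "exp (- k * (c - x)) * exp (- x) = exp (- k * c) * exp ((k - 1) * x)" for x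
      by (simp add: algebra_simps flip: exp_add)
    show "(F1 has_real_derivative exp (- k * (c - x)) * exp (- x)) (at x)" for x
      unfolding eq F1_def using assms by (intro has_real_derivative_exp_scaled) simp
    have eq: "exp (- k * (x - c)) * exp (- x) = exp (k * c) * exp ((- k - 1) * x)" for x
      by (simp add: algebra_simps flip: exp_add)
    show "(F2 has_real_derivative exp (- k * (x - c)) * exp (- x)) (at x)" for x
      unfolding eq F2_def using assms by (intro has_real_derivative_exp_scaled) simp
    show "(F2 \<longlongrightarrow> 0) at_top"
      using assms unfolding F2_def by real_asymp
  qed (use assms in auto)
  also have "F2 c = - (exp (- c) / (k + 1))"
    using assms unfolding F2_def by (simp add: divide_simps) (simp add: algebra_simps flip: exp_add)
  also have "F1 c - F1 0 = (exp (- c) - exp (- k * c)) / (k - 1)"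
    using assms unfolding F1_def by (simp add: divide_simps) (simp add: algebra_simps flip: exp_add)
  also have "0 - - (exp (- c) / (k + 1)) + (exp (- c) - exp (- k * c)) / (k - 1) =
      (2 * k * exp (- c) - (k + 1) * exp (- k * c)) / ((k + 1) * (k - 1))"
    using assms by (simp add: divide_simps) (simp add: algebra_simps)
  also have "(k + 1) * (k - 1) = k\<^sup>2 - 1"
    by (simp add: power2_eq_square algebra_simps)
  finally show ?thesis .
qed

lemma std_exp_laplace:
  fixes k :: real
  assumes "0 < k"
  shows "has_bochner_integral std_exp (\<lambda>x. exp (- k * x)) (1 / (k + 1))"
proof -
  define F where "F = (\<lambda>z. 1 * exp ((- k - 1) * z) / (- k - 1))"
  have "has_bochner_integral std_exp (\<lambda>x. exp (- k * x)) (0 - F 0 + (F 0 - F 0))"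
  proof (rule has_bochner_integral_std_exp_split[where ?f1.0 = "\<lambda>x. exp (- k * x)"
        and ?f2.0 = "\<lambda>x. exp (- k * x)"])
    have eq: "exp (- k * x) * exp (- x) = 1 * exp ((- k - 1) * x)" for x
      by (simp add: algebra_simps flip: exp_add)
    show "(F has_real_derivative exp (- k * x) * exp (- x)) (at x)" for x
      unfolding eq F_def using assms by (intro has_real_derivative_exp_scaled) simp
    then show "(F has_real_derivative exp (- k * x) * exp (- x)) (at x)" for x .
    show "(F \<longlongrightarrow> 0) at_top"
      using assms unfolding F_def by real_asymp
  qed auto
  also have "0 - F 0 + (F 0 - F 0) = 1 / (k + 1)"
    using assms unfolding F_def by (simp add: divide_simps)
  finally show ?thesis .
qed

lemma std_exp_min:
  fixes c :: real
  assumes "0 \<le> c"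
  shows "has_bochner_integral std_exp (\<lambda>x. min x c) (1 - exp (- c))"
proof -
  define F1 where "F1 = (\<lambda>x::real. - (x + 1) * exp (- x))"
  define F2 where "F2 = (\<lambda>x::real. - c * exp (- x))"
  have "has_bochner_integral std_exp (\<lambda>x. min x c) (0 - F2 c + (F1 c - F1 0))"
  proof (rule has_bochner_integral_std_exp_split[where ?f1.0 = "\<lambda>x. x" and ?f2.0 = "\<lambda>x. c"])
    show "(F1 has_real_derivative x * exp (- x)) (at x)" for x
      unfolding F1_def by (auto intro!: derivative_eq_intros simp: algebra_simps)
    show "(F2 has_real_derivative c * exp (- x)) (at x)" for x
      unfolding F2_def by (auto intro!: derivative_eq_intros)
    show "(F2 \<longlongrightarrow> 0) at_top"
      unfolding F2_def by real_asymp
  qed (use assms in auto)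
  then show ?thesis
    by (simp add: F1_def F2_def algebra_simps)
qed

lemma nn_integral_std_exp_square: "(\<integral>\<^sup>+x. ennreal (x\<^sup>2) \<partial>std_exp) = 2"
proof -
  have "(\<integral>\<^sup>+x. ennreal (x\<^sup>2) \<partial>std_exp) =
      (\<integral>\<^sup>+x. ennreal (erlang_density 0 1 x * x ^ 2) \<partial>lborel)"
    by (subst nn_integral_density) (auto simp: ennreal_mult')
  then show ?thesis
    using nn_integral_erlang_ith_moment[of 1 0 2] by simp
qed

section \<open>Expectations over the three weights of a column\<close>

abbreviation exp_triple :: "(real \<times> real \<times> real) measure" where
  "exp_triple \<equiv> std_exp \<Otimes>\<^sub>M std_exp \<Otimes>\<^sub>M std_exp"

lemma pair_prob_space_std_exp: "pair_prob_space std_exp std_exp"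
  by (intro pair_prob_space.intro pair_sigma_finite.intro prob_space_imp_sigma_finite prob_space_std_exp)

lemma prob_space_exp_triple: "prob_space exp_triple"
  by (intro prob_space_pair prob_space_std_exp)

text \<open>The second order integrates over \<open>x\<close> while \<open>y\<close> is fixed, so
  that the functions of \<open>u + y - x\<close> and \<open>min x (u + y)\<close> are
  one-dimensional integrals with the nonnegative parameter \<open>u + y\<close>.\<close>

lemma nn_integral_exp_triple:
  assumes [measurable]: "f \<in> borel_measurable (borel \<Otimes>\<^sub>M borel \<Otimes>\<^sub>M borel)"
  shows "(\<integral>\<^sup>+p. f p \<partial>exp_triple) = (\<integral>\<^sup>+x. \<integral>\<^sup>+y. \<integral>\<^sup>+z. f (x, y, z) \<partial>std_exp \<partial>std_exp \<partial>std_exp)"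
    and "(\<integral>\<^sup>+p. f p \<partial>exp_triple) = (\<integral>\<^sup>+y. \<integral>\<^sup>+x. \<integral>\<^sup>+z. f (x, y, z) \<partial>std_exp \<partial>std_exp \<partial>std_exp)"
proof -
  interpret E: prob_space std_exp
    by (rule prob_space_std_exp)
  interpret EE: pair_prob_space std_exp std_exp
    by (rule pair_prob_space_std_exp)
  have [measurable]: "f \<in> borel_measurable exp_triple"
    using assms by (subst measurable_cong_sets) (auto intro!: sets_pair_measure_cong)
  show "(\<integral>\<^sup>+p. f p \<partial>exp_triple) = (\<integral>\<^sup>+x. \<integral>\<^sup>+y. \<integral>\<^sup>+z. f (x, y, z) \<partial>std_exp \<partial>std_exp \<partial>std_exp)"
    by (subst EE.P.nn_integral_fst[symmetric], measurable)
       (intro nn_integral_cong E.nn_integral_fst[symmetric], measurable)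
  also have "\<dots> = (\<integral>\<^sup>+y. \<integral>\<^sup>+x. \<integral>\<^sup>+z. f (x, y, z) \<partial>std_exp \<partial>std_exp \<partial>std_exp)"
    by (intro EE.Fubini'[symmetric]) measurable
  finally show "(\<integral>\<^sup>+p. f p \<partial>exp_triple) = (\<integral>\<^sup>+y. \<integral>\<^sup>+x. \<integral>\<^sup>+z. f (x, y, z) \<partial>std_exp \<partial>std_exp \<partial>std_exp)" .
qed

lemma has_bochner_integral_nonneg_imp_nn_integral:
  fixes f :: "'b \<Rightarrow> real"
  assumes "has_bochner_integral M f v" "AE x in M. 0 \<le> f x"
  shows "(\<integral>\<^sup>+x. ennreal (f x) \<partial>M) = ennreal v" and "0 \<le> v"
  using assms nn_integral_eq_integral[where M = M and f = f] integral_nonneg_AE[where M = M and f = f]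
  by (auto simp: has_bochner_integral_iff)

lemma (in prob_space) has_bochner_integral_constant: "has_bochner_integral M (\<lambda>_. c :: real) c"
  by (simp add: has_bochner_integral_iff prob_space)

lemma AE_exp_triple_nonneg: "AE p in exp_triple. 0 \<le> fst p \<and> 0 \<le> fst (snd p) \<and> 0 \<le> snd (snd p)"
proof -
  interpret EE: pair_prob_space std_exp std_exp
    by (rule pair_prob_space_std_exp)
  interpret E3: pair_prob_space std_exp "std_exp \<Otimes>\<^sub>M std_exp"
    by (intro pair_prob_space.intro pair_sigma_finite.intro prob_space_imp_sigma_finite
        prob_space_std_exp prob_space_pair)
  have "AE q in std_exp \<Otimes>\<^sub>M std_exp. 0 \<le> fst q \<and> 0 \<le> snd q"
  proof (rule EE.AE_pair_measure)
    show "{q \<in> space (std_exp \<Otimes>\<^sub>M std_exp). 0 \<le> fst q \<and> 0 \<le> snd q} \<in> sets (std_exp \<Otimes>\<^sub>M std_exp)"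
      by measurable
  qed (use AE_std_exp_nonneg in auto)
  then have AE: "AE x in std_exp. AE q in std_exp \<Otimes>\<^sub>M std_exp. 0 \<le> x \<and> 0 \<le> fst q \<and> 0 \<le> snd q"
    using AE_std_exp_nonneg by auto
  show ?thesis
  proof (rule E3.AE_pair_measure)
    show "{p \<in> space exp_triple. 0 \<le> fst p \<and> 0 \<le> fst (snd p) \<and> 0 \<le> snd (snd p)} \<in> sets exp_triple"
      by measurable
  qed (use AE in simp)
qed

lemma measurable_exp_triple:
  "borel_measurable exp_triple = borel_measurable (borel \<Otimes>\<^sub>M borel \<Otimes>\<^sub>M borel)"
  by (intro measurable_cong_sets sets_pair_measure_cong) auto

lemma exp_triple_laplace:
  fixes m u :: real
  assumes m: "0 < m" and u: "0 \<le> u"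
  shows "has_bochner_integral exp_triple (\<lambda>(x, y, z). exp (- m * min \<bar>u + y - x\<bar> z))
    (1 / (m + 1) + exp (- u) / (m + 2) - exp (- (m + 1) * u) / ((m + 1) * (m + 2)))"
proof -
  interpret E: prob_space std_exp
    by (rule prob_space_std_exp)
  let ?k = "m + 1"
  \<comment> \<open>\<open>g (u + y)\<close> is what remains after integrating out \<open>z\<close>
    and then \<open>x\<close>; it simplifies to a combination of 1, exp(-c) and exp(-(m+1)c) at
    \<open>c = u + y\<close>, which is then integrated termwise over \<open>y\<close>.\<close>
  define g where "g c = 1 / ?k + m / ?k * ((2 * ?k * exp (- c) - (?k + 1) * exp (- ?k * c)) / (?k\<^sup>2 - 1))"
    for c
  define V where "V = 1 / (m + 1) + exp (- u) / (m + 2) - exp (- (m + 1) * u) / ((m + 1) * (m + 2))"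
  have "has_bochner_integral std_exp (\<lambda>z. exp (- m * min v z)) (1 / ?k + m / ?k * exp (- ?k * v))"
    if "0 \<le> v" for v
    using std_exp_laplace_min[OF m that] .
  from has_bochner_integral_nonneg_imp_nn_integral(1)[OF this]
  have z: "(\<integral>\<^sup>+z. ennreal (exp (- m * min \<bar>u + y - x\<bar> z)) \<partial>std_exp) =
      ennreal (1 / ?k + m / ?k * exp (- ?k * \<bar>u + y - x\<bar>))" for x y
    by auto
  have x: "(\<integral>\<^sup>+x. ennreal (1 / ?k + m / ?k * exp (- ?k * \<bar>u + y - x\<bar>)) \<partial>std_exp) = ennreal (g (u + y))"
    "0 \<le> g (u + y)" if "0 \<le> y" for y
  proof -
    have "has_bochner_integral std_exp (\<lambda>x. 1 / ?k + m / ?k * exp (- ?k * \<bar>u + y - x\<bar>)) (g (u + y))"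
      unfolding g_def using m u that
      by (intro has_bochner_integral_add has_bochner_integral_mult_right std_exp_laplace_dist
          E.has_bochner_integral_constant) auto
    from has_bochner_integral_nonneg_imp_nn_integral[OF this]
    show "(\<integral>\<^sup>+x. ennreal (1 / ?k + m / ?k * exp (- ?k * \<bar>u + y - x\<bar>)) \<partial>std_exp) = ennreal (g (u + y))"
      "0 \<le> g (u + y)"
      using m by auto
  qed
  have g: "g (u + y) = 1 / ?k + (2 / (m + 2) * exp (- u) * exp (- 1 * y) -
      1 / ?k * exp (- ?k * u) * exp (- ?k * y))" for y
  proof -
    have "?k\<^sup>2 - 1 = m * (m + 2)"
      by (simp add: power2_eq_square algebra_simps)
    then have "g c = 1 / ?k + (2 / (m + 2) * exp (- c) - 1 / ?k * exp (- ?k * c))" for c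
      using m unfolding g_def by (simp add: divide_simps) (simp add: algebra_simps)
    moreover have "exp (- (u + y)) = exp (- u) * exp (- 1 * y)"
      "exp (- ?k * (u + y)) = exp (- ?k * u) * exp (- ?k * y)"
      by (simp_all add: algebra_simps flip: exp_add)
    ultimately show ?thesis
      by (simp only: mult.assoc)
  qed
  have y: "has_bochner_integral std_exp (\<lambda>y. g (u + y)) (1 / ?k + (2 / (m + 2) * exp (- u) * (1 / (1 + 1)) -
      1 / ?k * exp (- ?k * u) * (1 / (?k + 1))))"
    unfolding g using m
    by (intro has_bochner_integral_add has_bochner_integral_diff has_bochner_integral_mult_right
        std_exp_laplace E.has_bochner_integral_constant) auto
  have V_eq: "1 / ?k + (2 / (m + 2) * exp (- u) * (1 / (1 + 1)) -
      1 / ?k * exp (- ?k * u) * (1 / (?k + 1))) = V"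
    using m unfolding V_def by (simp add: divide_simps) (simp add: algebra_simps)?
  have AE_g: "AE y in std_exp. 0 \<le> g (u + y)"
    using AE_std_exp_nonneg by eventually_elim (rule x(2))
  note y_nn = has_bochner_integral_nonneg_imp_nn_integral[OF y[unfolded V_eq] AE_g]
  have "(\<integral>\<^sup>+p. ennreal (case p of (x, y, z) \<Rightarrow> exp (- m * min \<bar>u + y - x\<bar> z)) \<partial>exp_triple) =
      (\<integral>\<^sup>+y. \<integral>\<^sup>+x. ennreal (1 / ?k + m / ?k * exp (- ?k * \<bar>u + y - x\<bar>)) \<partial>std_exp \<partial>std_exp)"
    by (subst nn_integral_exp_triple(2)) (auto simp only: z prod.case, measurable)
  also have "\<dots> = (\<integral>\<^sup>+y. ennreal (g (u + y)) \<partial>std_exp)"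
    using AE_std_exp_nonneg by (intro nn_integral_cong_AE, eventually_elim) (rule x(1))
  finally have "(\<integral>\<^sup>+p. ennreal (case p of (x, y, z) \<Rightarrow> exp (- m * min \<bar>u + y - x\<bar> z)) \<partial>exp_triple) = ennreal V"
    using y_nn(1) by simp
  then show ?thesis
    unfolding V_def[symmetric] using y_nn(2)
    by (intro has_bochner_integral_nn_integral) (auto simp: measurable_exp_triple split: prod.split)
qed

lemma exp_triple_min:
  fixes u :: real
  assumes u: "0 \<le> u"
  shows "has_bochner_integral exp_triple (\<lambda>(x, y, z). min x (u + y)) (1 - exp (- u) / 2)"
proof -
  interpret E: prob_space std_exp
    by (rule prob_space_std_exp)
  have x: "(\<integral>\<^sup>+x. ennreal (min x (u + y)) \<partial>std_exp) = ennreal (1 - exp (- (u + y)))"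
    if "0 \<le> y" for y
  proof (rule has_bochner_integral_nonneg_imp_nn_integral(1)[OF std_exp_min])
    show "AE x in std_exp. 0 \<le> min x (u + y)"
      using AE_std_exp_nonneg by eventually_elim (use u that in auto)
  qed (use u that in auto)
  have g: "1 - exp (- (u + y)) = 1 - exp (- u) * exp (- 1 * y)" for y
    by (simp add: algebra_simps flip: exp_add)
  have y: "has_bochner_integral std_exp (\<lambda>y. 1 - exp (- (u + y))) (1 - exp (- u) * (1 / (1 + 1)))"
    unfolding g
    by (intro has_bochner_integral_diff has_bochner_integral_mult_right
        std_exp_laplace E.has_bochner_integral_constant) auto
  have "AE y in std_exp. 0 \<le> 1 - exp (- (u + y))"
    using AE_std_exp_nonneg by eventually_elim (use u in auto)
  note y_nn = has_bochner_integral_nonneg_imp_nn_integral[OF y this]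
  have "(\<integral>\<^sup>+p. ennreal (case p of (x, y, z) \<Rightarrow> min x (u + y)) \<partial>exp_triple) =
      (\<integral>\<^sup>+y. \<integral>\<^sup>+x. ennreal (min x (u + y)) \<partial>std_exp \<partial>std_exp)"
    by (subst nn_integral_exp_triple(2)) (auto simp: E.emeasure_space_1[simplified])
  also have "\<dots> = (\<integral>\<^sup>+y. ennreal (1 - exp (- (u + y))) \<partial>std_exp)"
    using AE_std_exp_nonneg by (intro nn_integral_cong_AE, eventually_elim) (rule x)
  finally have "(\<integral>\<^sup>+p. ennreal (case p of (x, y, z) \<Rightarrow> min x (u + y)) \<partial>exp_triple) = ennreal (1 - exp (- u) / 2)"
    using y_nn(1) by simp
  moreover have "AE p in exp_triple. 0 \<le> (case p of (x, y, z) \<Rightarrow> min x (u + y))"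
    using AE_exp_triple_nonneg by eventually_elim (use u in \<open>auto split: prod.split\<close>)
  ultimately show ?thesis
    using y_nn(2)
    by (intro has_bochner_integral_nn_integral) (auto simp: measurable_exp_triple split: prod.split)
qed

text \<open>The two iterated integrals of \<open>nn_integral_exp_triple\<close> differ by exactly
  this exchange of rails. The symmetry reduces the drift computation to states with
  \<open>a \<le> b\<close>.\<close>

lemma distr_exp_triple_swap: "distr exp_triple exp_triple (\<lambda>(x, y, z). (y, x, z)) = exp_triple"
proof (rule measure_eqI)
  have M [measurable]: "(\<lambda>(x, y, z). (y, x, z)) \<in> measurable exp_triple exp_triple"
    by measurable
  fix A assume "A \<in> sets (distr exp_triple exp_triple (\<lambda>(x, y, z). (y, x, z)))"
  then have A: "A \<in> sets exp_triple"
    by simp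
  then have A': "A \<in> sets (borel \<Otimes>\<^sub>M borel \<Otimes>\<^sub>M borel)"
    by (subst (asm) sets_pair_measure_cong[OF _ sets_pair_measure_cong]) auto
  have i: "indicator A \<in> borel_measurable (borel \<Otimes>\<^sub>M borel \<Otimes>\<^sub>M borel :: (real \<times> real \<times> real) measure)"
    using A' by simp
  then have i': "(\<lambda>(x, y, z). indicator A (y, x, z)) \<in> borel_measurable (borel \<Otimes>\<^sub>M borel \<Otimes>\<^sub>M borel :: (real \<times> real \<times> real) measure)"
    by measurable
  have "emeasure (distr exp_triple exp_triple (\<lambda>(x, y, z). (y, x, z))) A =
      (\<integral>\<^sup>+p. indicator A p \<partial>distr exp_triple exp_triple (\<lambda>(x, y, z). (y, x, z)))"
    using A by simp
  also have "\<dots> = (\<integral>\<^sup>+p. (case p of (x, y, z) \<Rightarrow> indicator A (y, x, z)) \<partial>exp_triple)"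
    using A by (subst nn_integral_distr) (auto intro!: nn_integral_cong split: prod.split)
  also have "\<dots> = (\<integral>\<^sup>+p. indicator A p \<partial>exp_triple)"
    unfolding nn_integral_exp_triple(1)[OF i] nn_integral_exp_triple(2)[OF i'] by simp
  finally show "emeasure (distr exp_triple exp_triple (\<lambda>(x, y, z). (y, x, z))) A = emeasure exp_triple A"
    using A by simp
qed simp

lemma has_bochner_integral_exp_triple_swap:
  fixes f :: "real \<times> real \<times> real \<Rightarrow> real"
  assumes "has_bochner_integral exp_triple f v"
  shows "has_bochner_integral exp_triple (\<lambda>(x, y, z). f (y, x, z)) v"
proof -
  have [measurable]: "f \<in> borel_measurable exp_triple"
    using assms by (auto simp: has_bochner_integral_iff)
  have M: "(\<lambda>(x, y, z). (y, x, z)) \<in> measurable exp_triple exp_triple"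
    by measurable
  have "has_bochner_integral (distr exp_triple exp_triple (\<lambda>(x, y, z). (y, x, z))) f v"
    using assms by (simp only: distr_exp_triple_swap)
  then show ?thesis
    using integrable_distr_eq[OF M, of f] integral_distr[OF M, of f]
    by (simp add: has_bochner_integral_iff case_prod_unfold)
qed

definition ladder_speed :: real where
  "ladder_speed = 3 / 2 - besselJ 1 2 / (2 * besselJ 2 2)"

text \<open>Expectation and series may be exchanged because the coefficients are absolutely summable
  and all expectations \<open>V k\<close> lie in [0,1]. The value contains
  \<open>ladder_speed - 1\<close> because the mean of \<open>min x (u + y)\<close> supplies the
  missing 1.\<close>

lemma exp_triple_corrector:
  fixes u :: real
  assumes u: "0 \<le> u"
  shows "has_bochner_integral exp_triple (\<lambda>(x, y, z). corrector (exp (- min \<bar>u + y - x\<bar> z)))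
    (ladder_speed - 1 + exp (- u) / 2 + corrector (exp (- u)))"
proof -
  define E where "E k = (\<lambda>(x, y, z). exp (- (real k + 1) * min \<bar>u + y - x\<bar> z))" for k
  define V where "V k = 1 / (real k + 2) + exp (- u) / (real k + 3) -
      exp (- u) ^ (k + 2) / ((real k + 2) * (real k + 3))" for k
  have hb: "has_bochner_integral exp_triple (E k) (V k)" for k
  proof -
    have "exp (- (real k + 1 + 1) * u) = exp (- u) ^ (k + 2)"
      by (simp only: exp_of_nat_mult[symmetric]) (simp add: algebra_simps)
    then show ?thesis
      using exp_triple_laplace[OF _ u, of "real k + 1"] unfolding E_def V_def
      by (simp add: add.assoc add.commute)
  qed
  have E_eq: "E k = (\<lambda>(x, y, z). exp (- min \<bar>u + y - x\<bar> z) ^ (k + 1))" for k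
    unfolding E_def by (simp only: exp_of_nat_mult[symmetric]) (auto simp: fun_eq_iff algebra_simps)
  have small: "AE p in exp_triple. \<bar>case p of (x, y, z) \<Rightarrow> exp (- min \<bar>u + y - x\<bar> z)\<bar> \<le> 1"
    using AE_exp_triple_nonneg by eventually_elim (auto split: prod.split)
  define f where "f k p = corrector_coeff k * E k p" for k p
  have f: "has_bochner_integral exp_triple (f k) (corrector_coeff k * V k)" for k
    unfolding f_def by (intro has_bochner_integral_mult_right hb)
  have nf: "has_bochner_integral exp_triple (\<lambda>p. norm (f k p)) (\<bar>corrector_coeff k\<bar> * V k)" for k
  proof -
    have "norm (f k p) = \<bar>corrector_coeff k\<bar> * E k p" for p
      by (auto simp: f_def E_def abs_mult split: prod.split)
    then show ?thesis
      by (simp only: has_bochner_integral_mult_right hb)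
  qed
  have V: "0 \<le> V k" "V k \<le> 1" for k
  proof -
    \<comment> \<open>The sign is read off from \<open>V k\<close> being the expectation of a
      positive variable rather than from its formula.\<close>
    show "0 \<le> V k"
      by (rule has_bochner_integral_nonneg_imp_nn_integral(2)[OF hb]) (auto simp: E_def split: prod.split)
    have "exp (- u) / (real k + 3) \<le> 1 / 3"
      using u frac_le[of 1 "exp (- u)" 3 "real k + 3"] by auto
    moreover have "1 / (real k + 2) \<le> 1 / 2"
      by (intro divide_left_mono) auto
    moreover have "0 \<le> exp (- u) ^ (k + 2) / ((real k + 2) * (real k + 3))"
      by simp
    ultimately show "V k \<le> 1"
      unfolding V_def by linarith
  qed
  have AE_sum: "AE p in exp_triple. summable (\<lambda>k. norm (f k p))"
    using small
  proof eventually_elim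
    case (elim p)
    from corrector_summable(1)[OF this] show ?case
      by (cases p) (simp add: f_def E_eq)
  qed
  have sum: "summable (\<lambda>k. \<integral>p. norm (f k p) \<partial>exp_triple)"
  proof (rule summable_comparison_test'[OF corrector_coeff_summable])
    show "norm (\<integral>p. norm (f k p) \<partial>exp_triple) \<le> \<bar>corrector_coeff k\<bar>" for k
      using V[of k] mult_left_le[of "V k" "\<bar>corrector_coeff k\<bar>"] nf[of k]
      by (auto simp: has_bochner_integral_iff abs_mult)
  qed
  have int: "integrable exp_triple (f k)" for k
    using f by (auto simp: has_bochner_integral_iff)
  have "(\<lambda>k. corrector_coeff k * V k) sums (1 / 2 - besselJ 1 2 / (2 * besselJ 2 2) + exp (- u) / 2 + corrector (exp (- u)))"
    unfolding V_def using u by (intro poisson_series) auto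
  moreover have "(\<integral>p. f k p \<partial>exp_triple) = corrector_coeff k * V k" for k
    using f by (auto simp: has_bochner_integral_iff)
  ultimately have "(\<integral>p. (\<Sum>k. f k p) \<partial>exp_triple) = ladder_speed - 1 + exp (- u) / 2 + corrector (exp (- u))"
    by (simp add: integral_suminf[OF int AE_sum sum] sums_iff ladder_speed_def)
  then have "has_bochner_integral exp_triple (\<lambda>p. \<Sum>k. f k p) (ladder_speed - 1 + exp (- u) / 2 + corrector (exp (- u)))"
    by (simp add: has_bochner_integral_iff integrable_suminf[OF int AE_sum sum])
  moreover have "(\<Sum>k. f k p) = (case p of (x, y, z) \<Rightarrow> corrector (exp (- min \<bar>u + y - x\<bar> z)))" for p
    by (simp add: f_def E_eq corrector_def split: prod.split)
  ultimately show ?thesis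
    by (simp only:)
qed

section \<open>The one-step drift and its second moment\<close>

text \<open>The process \<open>potential (a\<^sub>n, b\<^sub>n) - n * ladder_speed\<close> is the martingale of the argument.\<close>

definition potential :: "real \<times> real \<Rightarrow> real" where
  "potential = (\<lambda>(a, b). min a b + corrector (exp (- \<bar>b - a\<bar>)))"

lemma measurable_potential [measurable]: "potential \<in> borel_measurable (borel \<Otimes>\<^sub>M borel)"
  unfolding potential_def by measurable

lemma measurable_ladder_step [measurable (raw)]:
  assumes [measurable]: "f \<in> measurable N (borel \<Otimes>\<^sub>M borel)" "g \<in> measurable N (borel \<Otimes>\<^sub>M borel \<Otimes>\<^sub>M borel)"
  shows "(\<lambda>x. ladder_step (f x) (g x)) \<in> measurable N (borel \<Otimes>\<^sub>M borel)"
  unfolding ladder_step_def case_prod_unfold by measurable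

lemma measurable_ladder_step_exp_triple [measurable]:
  "(\<lambda>p. potential (ladder_step s p)) \<in> borel_measurable exp_triple"
  unfolding measurable_exp_triple
  by (intro measurable_compose[OF measurable_ladder_step measurable_potential]
      measurable_ident_sets refl)
     (simp add: space_pair_measure)

lemma ladder_step_swap:
  "ladder_step (b, a) (y, x, z) = prod.swap (ladder_step (a, b) (x, y, z))"
  by (simp add: ladder_step_def)

lemma potential_swap: "potential (prod.swap s) = potential s"
  by (simp add: potential_def min.commute abs_minus_commute split: prod.split)

text \<open>The rail that arrives first in the new column is reached without the new rung, which
  gives the minimum; the other end is then at most \<open>z\<close> behind, which caps the
  gap.\<close>

lemma potential_step:
  assumes "a \<le> b" "0 \<le> x" "0 \<le> y" "0 \<le> z"
  shows "potential (ladder_step (a, b) (x, y, z)) =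
    a + min x ((b - a) + y) + corrector (exp (- min \<bar>(b - a) + y - x\<bar> z))"
proof -
  let ?a = "min (a + x) (b + y + z)" and ?b = "min (b + y) (a + x + z)"
  have "min ?a ?b = a + min x ((b - a) + y) \<and> \<bar>?b - ?a\<bar> = min \<bar>(b - a) + y - x\<bar> z"
  proof (cases "a + x \<le> b + y")
    case True
    then have "?a = a + x"
      using assms by simp
    then show ?thesis
      using True assms by (auto simp: min_def)
  next
    case False
    then have "?b = b + y"
      using assms by simp
    then show ?thesis
      using False assms by (auto simp: min_def)
  qed
  then show ?thesis
    by (simp add: potential_def ladder_step_def)
qed

text \<open>The terms \<open>exp (- u) / 2\<close> in the means of the minimum and of the corrector
  cancel; this is the Poisson equation. Having it for every fixed state \<open>s\<close> allows
  integration against the law of the current state later on.\<close>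

lemma potential_drift:
  "has_bochner_integral exp_triple (\<lambda>p. potential (ladder_step s p) - potential s - ladder_speed) 0"
proof -
  interpret E: prob_space exp_triple
    by (rule prob_space_exp_triple)
  have le: "has_bochner_integral exp_triple
      (\<lambda>p. potential (ladder_step (a, b) p) - potential (a, b) - ladder_speed) 0" if "a \<le> b" for a b
  proof -
    let ?u = "b - a"
    let ?f = "\<lambda>p. (case p of (x, y, z) \<Rightarrow> min x (?u + y)) +
        (case p of (x, y, z) \<Rightarrow> corrector (exp (- min \<bar>?u + y - x\<bar> z))) -
        (corrector (exp (- ?u)) + ladder_speed)"
    have "has_bochner_integral exp_triple ?f
       ((1 - exp (- ?u) / 2) + (ladder_speed - 1 + exp (- ?u) / 2 + corrector (exp (- ?u))) -
        (corrector (exp (- ?u)) + ladder_speed))"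
      using that by (intro has_bochner_integral_diff has_bochner_integral_add exp_triple_min
          exp_triple_corrector E.has_bochner_integral_constant) auto
    moreover have "AE p in exp_triple. ?f p = potential (ladder_step (a, b) p) - potential (a, b) - ladder_speed"
      using AE_exp_triple_nonneg
    proof eventually_elim
      case (elim p)
      then show ?case
        using that by (cases p) (simp add: potential_step, simp add: potential_def)
    qed
    moreover have "?f \<in> borel_measurable exp_triple"
      unfolding measurable_exp_triple by measurable
    ultimately show ?thesis
      by (subst has_bochner_integral_cong_AE[symmetric, where f = ?f]) auto
  qed
  obtain a b where s: "s = (a, b)"
    by fastforce
  show ?thesis
  proof (cases "a \<le> b")
    case True
    then show ?thesis
      using le s by simp
  next
    case False
    then have "has_bochner_integral exp_triple
      (\<lambda>(x, y, z). potential (ladder_step (b, a) (y, x, z)) - potential (b, a) - ladder_speed) 0"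
      using has_bochner_integral_exp_triple_swap[OF le[of b a]] by simp
    moreover have "(\<lambda>(x, y, z). potential (ladder_step (b, a) (y, x, z)) - potential (b, a) - ladder_speed) =
        (\<lambda>p. potential (ladder_step s p) - potential s - ladder_speed)"
      using potential_swap[of "(a, b)"]
      by (auto simp: s fun_eq_iff ladder_step_swap[of b a] potential_swap)
    ultimately show ?thesis
      by simp
  qed
qed

definition corrector_bound :: real where
  "corrector_bound = (\<Sum>k. \<bar>corrector_coeff k\<bar>)"

lemma corrector_exp_bound: "0 \<le> v \<Longrightarrow> \<bar>corrector (exp (- v))\<bar> \<le> corrector_bound"
  unfolding corrector_bound_def by (rule corrector_bounded) simp

text \<open>The minimum moves by at most \<open>x + y\<close> and the corrector is bounded, so the
  estimate is uniform in the state \<open>s\<close>.\<close>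

lemma potential_increment_bound:
  assumes "0 \<le> x" "0 \<le> y" "0 \<le> z"
  shows "(potential (ladder_step s (x, y, z)) - potential s - ladder_speed)\<^sup>2 \<le>
    3 * (x\<^sup>2 + y\<^sup>2 + (2 * corrector_bound + \<bar>ladder_speed\<bar>)\<^sup>2)"
proof -
  obtain a b where s: "s = (a, b)"
    by fastforce
  let ?K = "2 * corrector_bound + \<bar>ladder_speed\<bar>"
  obtain a' b' where s': "ladder_step (a, b) (x, y, z) = (a', b')"
    by fastforce
  then have "\<bar>min a' b' - min a b\<bar> \<le> x + y"
    using assms by (auto simp: ladder_step_def)
  have "\<bar>potential (ladder_step s (x, y, z)) - potential s - ladder_speed\<bar> \<le> x + y + ?K"
  proof -
    have "\<bar>p' + c' - (p + c) - l\<bar> \<le> d + (2 * C + \<bar>l\<bar>)"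
      if "\<bar>p' - p\<bar> \<le> d" "\<bar>c\<bar> \<le> C" "\<bar>c'\<bar> \<le> C" for p p' c c' d C l :: real
      using that by linarith
    with corrector_exp_bound[of "\<bar>b - a\<bar>"] corrector_exp_bound[of "\<bar>b' - a'\<bar>"]
      \<open>\<bar>min a' b' - min a b\<bar> \<le> x + y\<close>
    show ?thesis
      by (simp only: s s' potential_def prod.case abs_ge_zero)
  qed
  then have "(potential (ladder_step s (x, y, z)) - potential s - ladder_speed)\<^sup>2 \<le> (x + y + ?K)\<^sup>2"
    by (metis abs_ge_zero power2_abs power_mono)
  also have "\<dots> \<le> 3 * (x\<^sup>2 + y\<^sup>2 + ?K\<^sup>2)"
  proof -
    \<comment> \<open>Cauchy-Schwarz for three summands, with the deficit written as a sum of
      squares.\<close>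
    have "3 * (x\<^sup>2 + y\<^sup>2 + ?K\<^sup>2) - (x + y + ?K)\<^sup>2 = (x - y)\<^sup>2 + (x - ?K)\<^sup>2 + (y - ?K)\<^sup>2"
      by (simp add: power2_eq_square algebra_simps)
    then show ?thesis
      using zero_le_power2[of "x - y"] zero_le_power2[of "x - ?K"] zero_le_power2[of "y - ?K"] by linarith
  qed
  finally show ?thesis .
qed

text \<open>The 4 is the sum of the second moments, 2 each, of the two horizontal weights.\<close>

definition variance_bound :: real where
  "variance_bound = 3 * (4 + (2 * corrector_bound + \<bar>ladder_speed\<bar>)\<^sup>2)"

lemma variance_bound_nonneg: "0 \<le> variance_bound"
  by (simp add: variance_bound_def)

lemma potential_increment_square:
  "(\<integral>\<^sup>+p. ennreal ((potential (ladder_step s p) - potential s - ladder_speed)\<^sup>2) \<partial>exp_triple)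
    \<le> ennreal variance_bound"
proof -
  interpret E: prob_space std_exp
    by (rule prob_space_std_exp)
  let ?K = "(2 * corrector_bound + \<bar>ladder_speed\<bar>)\<^sup>2"
  have eq: "ennreal (3 * (x\<^sup>2 + y\<^sup>2 + ?K)) = ennreal 3 * (ennreal (x\<^sup>2) + ennreal (y\<^sup>2) + ennreal ?K)"
    for x y :: real
    by (simp add: ennreal_mult')
  have "(\<integral>\<^sup>+p. ennreal ((potential (ladder_step s p) - potential s - ladder_speed)\<^sup>2) \<partial>exp_triple)
      \<le> (\<integral>\<^sup>+p. (case p of (x, y, z) \<Rightarrow> ennreal 3 * (ennreal (x\<^sup>2) + ennreal (y\<^sup>2) + ennreal ?K)) \<partial>exp_triple)"
    using AE_exp_triple_nonneg
  proof (intro nn_integral_mono_AE, eventually_elim)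
    case (elim p)
    then show ?case
      using ennreal_leI[OF potential_increment_bound[of "fst p" "fst (snd p)" "snd (snd p)" s]]
      unfolding eq by (simp only: case_prod_unfold prod.collapse)
  qed
  also have "\<dots> = ennreal 3 * (2 + 2 + ennreal ?K)"
    by (subst nn_integral_exp_triple(1))
       (simp_all add: nn_integral_cmult nn_integral_add nn_integral_std_exp_square
          E.emeasure_space_1[simplified])
  also have "\<dots> = ennreal variance_bound"
  proof -
    have "2 + 2 + ennreal ?K = ennreal (4 + ?K)"
      by (simp flip: ennreal_plus ennreal_numeral)
    then show ?thesis
      by (simp add: variance_bound_def ennreal_mult)
  qed
  finally show ?thesis .
qed

text \<open>Orthogonality of increments with the state frozen: \<open>q\<close> is then a constant,
  so the cross term \<open>2 * q * \<xi> p\<close> integrates to 0 and only the variance of one step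
  is added.\<close>

lemma potential_second_moment_step:
  "(\<integral>\<^sup>+p. ennreal ((potential (ladder_step s p) - ladder_speed - r)\<^sup>2) \<partial>exp_triple)
    \<le> ennreal ((potential s - r)\<^sup>2) + ennreal variance_bound"
proof -
  interpret E: prob_space exp_triple
    by (rule prob_space_exp_triple)
  define \<xi> where "\<xi> = (\<lambda>p. potential (ladder_step s p) - potential s - ladder_speed)"
  define q where "q = potential s - r"
  have [measurable]: "\<xi> \<in> borel_measurable exp_triple"
    unfolding \<xi>_def by measurable
  have i: "integrable exp_triple \<xi>" and z: "(\<integral>p. \<xi> p \<partial>exp_triple) = 0"
    using potential_drift[of s] by (auto simp: \<xi>_def has_bochner_integral_iff)
  have le: "(\<integral>\<^sup>+p. ennreal ((\<xi> p)\<^sup>2) \<partial>exp_triple) \<le> ennreal variance_bound"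
    unfolding \<xi>_def by (rule potential_increment_square)
  then have i2: "integrable exp_triple (\<lambda>p. (\<xi> p)\<^sup>2)"
    by (intro integrableI_nonneg) (auto simp: le_less_trans)
  have le2: "(\<integral>p. (\<xi> p)\<^sup>2 \<partial>exp_triple) \<le> variance_bound"
    using le variance_bound_nonneg by (subst (asm) nn_integral_eq_integral[OF i2]) auto
  have "(\<integral>\<^sup>+p. ennreal ((potential (ladder_step s p) - ladder_speed - r)\<^sup>2) \<partial>exp_triple) =
      (\<integral>\<^sup>+p. ennreal (q\<^sup>2 + 2 * q * \<xi> p + (\<xi> p)\<^sup>2) \<partial>exp_triple)"
    by (simp add: \<xi>_def q_def power2_eq_square algebra_simps)
  also have "\<dots> = ennreal (\<integral>p. q\<^sup>2 + 2 * q * \<xi> p + (\<xi> p)\<^sup>2 \<partial>exp_triple)"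
  proof (rule nn_integral_eq_integral)
    show "AE p in exp_triple. 0 \<le> q\<^sup>2 + 2 * q * \<xi> p + (\<xi> p)\<^sup>2"
    proof (rule AE_I2)
      fix p
      have "q\<^sup>2 + 2 * q * \<xi> p + (\<xi> p)\<^sup>2 = (q + \<xi> p)\<^sup>2"
        by (simp add: power2_eq_square algebra_simps)
      then show "0 \<le> q\<^sup>2 + 2 * q * \<xi> p + (\<xi> p)\<^sup>2"
        by simp
    qed
  qed (use i i2 in auto)
  also have "(\<integral>p. q\<^sup>2 + 2 * q * \<xi> p + (\<xi> p)\<^sup>2 \<partial>exp_triple) = q\<^sup>2 + (\<integral>p. (\<xi> p)\<^sup>2 \<partial>exp_triple)"
    using i i2 z E.prob_space by simp
  also have "ennreal \<dots> \<le> ennreal (q\<^sup>2) + ennreal variance_bound"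
    using le2 variance_bound_nonneg by (simp flip: ennreal_plus add: ennreal_leI)
  finally show ?thesis
    by (simp add: q_def)
qed

section \<open>From second moments to pathwise limits\<close>

text \<open>By Tonelli the sum of all squares has finite expectation, hence is almost surely finite,
  and its terms tend to 0.\<close>

lemma AE_tendsto_zero_of_second_moments:
  fixes f :: "nat \<Rightarrow> 'b \<Rightarrow> real"
  assumes [measurable]: "\<And>k. f k \<in> borel_measurable M"
    and bound: "\<And>k. (\<integral>\<^sup>+x. ennreal ((f k x)\<^sup>2) \<partial>M) \<le> ennreal (c k)"
    and c: "summable c" "\<And>k. 0 \<le> c k"
  shows "AE x in M. (\<lambda>k. f k x) \<longlonglongrightarrow> 0"
proof -
  have "(\<integral>\<^sup>+x. (\<Sum>k. ennreal ((f k x)\<^sup>2)) \<partial>M) = (\<Sum>k. \<integral>\<^sup>+x. ennreal ((f k x)\<^sup>2) \<partial>M)"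
    by (intro nn_integral_suminf) measurable
  also have "\<dots> \<le> (\<Sum>k. ennreal (c k))"
    by (intro suminf_le bound) auto
  also have "\<dots> < \<infinity>"
    using c by (simp add: ennreal_suminf_neq_top less_top[symmetric])
  finally have "AE x in M. (\<Sum>k. ennreal ((f k x)\<^sup>2)) \<noteq> \<infinity>"
    by (intro nn_integral_noteq_infinite) auto
  then show ?thesis
  proof eventually_elim
    case (elim x)
    then have "summable (\<lambda>k. (f k x)\<^sup>2)"
      by (intro summable_suminf_not_top) auto
    then have "(\<lambda>k. (f k x)\<^sup>2) \<longlonglongrightarrow> 0"
      by (rule summable_LIMSEQ_zero)
    then have "(\<lambda>k. sqrt ((f k x)\<^sup>2)) \<longlonglongrightarrow> sqrt 0"
      by (rule tendsto_real_sqrt)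
    then show ?case
      by (simp add: tendsto_rabs_zero_iff)
  qed
qed

lemma summable_const_over_square: "summable (\<lambda>k. c / (real k)\<^sup>2)"
  using summable_mult[OF inverse_power_summable[of 2, where 'a = real], of c]
  by (simp add: divide_inverse)

text \<open>With r the integer part of sqrt n, monotonicity squeezes \<open>T n\<close> between its
  values at r^2 and (r+1)^2, and the ratio of these consecutive squares tends to 1.\<close>

lemma LIMSEQ_ratio_of_squares:
  fixes T :: "nat \<Rightarrow> real"
  assumes mono: "incseq T" and nonneg: "\<And>n. 0 \<le> T n"
    and lim: "(\<lambda>k. T (k\<^sup>2) / (real k)\<^sup>2) \<longlonglongrightarrow> c"
  shows "(\<lambda>n. T n / real n) \<longlonglongrightarrow> c"
proof (rule tendsto_sandwich)
  define r where "r n = nat \<lfloor>sqrt (real n)\<rfloor>" for n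
  have r_lim: "filterlim r at_top sequentially"
    unfolding r_def by real_asymp
  have r1: "(r n)\<^sup>2 \<le> n" and r2: "n \<le> (Suc (r n))\<^sup>2" for n
  proof -
    have "real (r n) \<le> sqrt (real n)" "sqrt (real n) \<le> real (r n) + 1"
      unfolding r_def by auto
    then have "(real (r n))\<^sup>2 \<le> (sqrt (real n))\<^sup>2" "(sqrt (real n))\<^sup>2 \<le> (real (r n) + 1)\<^sup>2"
      by (auto intro!: power_mono simp del: real_sqrt_pow2)
    then have "real ((r n)\<^sup>2) \<le> real n" "real n \<le> real ((Suc (r n))\<^sup>2)"
      by (auto simp: add.commute)
    then show "(r n)\<^sup>2 \<le> n" "n \<le> (Suc (r n))\<^sup>2"
      by (simp_all only: of_nat_le_iff)
  qed
  define lo where "lo k = T (k\<^sup>2) / (real k)\<^sup>2 * ((real k)\<^sup>2 / (real (Suc k))\<^sup>2)" for k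
  define up where "up k = T ((Suc k)\<^sup>2) / (real (Suc k))\<^sup>2 * ((real (Suc k))\<^sup>2 / (real k)\<^sup>2)" for k
  have "(\<lambda>k. (real k)\<^sup>2 / (real (Suc k))\<^sup>2) \<longlonglongrightarrow> 1" "(\<lambda>k. (real (Suc k))\<^sup>2 / (real k)\<^sup>2) \<longlonglongrightarrow> 1"
    by real_asymp+
  from tendsto_mult[OF lim this(1)] tendsto_mult[OF LIMSEQ_Suc[OF lim] this(2)]
  have "lo \<longlonglongrightarrow> c" "up \<longlonglongrightarrow> c"
    unfolding lo_def up_def by (simp_all only: mult_1_right)
  then show "(\<lambda>n. lo (r n)) \<longlonglongrightarrow> c" "(\<lambda>n. up (r n)) \<longlonglongrightarrow> c"
    using filterlim_compose[OF _ r_lim] by auto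
  have pos: "eventually (\<lambda>n. 0 < n \<and> 0 < r n) sequentially"
    using r_lim[unfolded filterlim_at_top, rule_format, of 1] eventually_gt_at_top[of 0]
    by eventually_elim auto
  show "eventually (\<lambda>n. lo (r n) \<le> T n / real n) sequentially"
    using pos
  proof eventually_elim
    case (elim n)
    have "real n \<le> (real (Suc (r n)))\<^sup>2"
      using r2[of n] by (metis of_nat_le_iff of_nat_power)
    then have "T ((r n)\<^sup>2) / (real (Suc (r n)))\<^sup>2 \<le> T n / real n"
      using elim r1[of n] mono nonneg by (intro frac_le) (auto simp: incseq_def)
    then show ?case
      using elim by (simp add: lo_def)
  qed
  show "eventually (\<lambda>n. T n / real n \<le> up (r n)) sequentially"
    using pos
  proof eventually_elim
    case (elim n)
    have "(real (r n))\<^sup>2 \<le> real n"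
      using r1[of n] by (metis of_nat_le_iff of_nat_power)
    then have "T n / real n \<le> T ((Suc (r n))\<^sup>2) / (real (r n))\<^sup>2"
      using elim r2[of n] mono nonneg by (intro frac_le) (auto simp: incseq_def)
    then show ?case
      by (simp add: up_def)
  qed
qed

text \<open>Monotonicity is a property of the minimum only: if the upper end is much closer, the
  distance to the lower end can drop from one column to the next.\<close>

lemma front_min:
  assumes "\<And>e. 0 \<le> t e"
  shows "incseq (\<lambda>n. min (fst (front t n)) (snd (front t n)))"
    and "0 \<le> min (fst (front t n)) (snd (front t n))"
proof -
  show inc: "incseq (\<lambda>n. min (fst (front t n)) (snd (front t n)))"
  proof (rule incseq_SucI)
    fix n
    show "min (fst (front t n)) (snd (front t n)) \<le> min (fst (front t (Suc n))) (snd (front t (Suc n)))"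
      using assms[of "Bot (Suc n)"] assms[of "Top (Suc n)"] assms[of "Rung (Suc n)"]
      unfolding fst_front_Suc snd_front_Suc by linarith
  qed
  show "0 \<le> min (fst (front t n)) (snd (front t n))"
    using incseqD[OF inc, of 0 n] assms[of "Rung 0"] by simp
qed

text \<open>This is the deterministic part of the argument, for a single realisation of the weights;
  probability enters only through the two limits assumed.\<close>

lemma front_speed:
  assumes t: "\<And>e. 0 \<le> t e"
    and rung: "(\<lambda>n. t (Rung n) / real n) \<longlonglongrightarrow> 0"
    and mart: "(\<lambda>k. (potential (front t (k\<^sup>2)) - real (k\<^sup>2) * ladder_speed) / (real k)\<^sup>2) \<longlonglongrightarrow> 0"
  shows "(\<lambda>n. fst (front t n) / real n) \<longlonglongrightarrow> ladder_speed"
proof -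
  define T where "T n = min (fst (front t n)) (snd (front t n))" for n
  define h where "h n = corrector (exp (- \<bar>snd (front t n) - fst (front t n)\<bar>))" for n
  have pot: "potential (front t n) = T n + h n" for n
    by (simp add: potential_def T_def h_def split: prod.split)
  have "(\<lambda>k. h (k\<^sup>2) / (real k)\<^sup>2) \<longlonglongrightarrow> 0"
  proof (rule tendsto_rabs_zero_cancel, rule tendsto_sandwich[where f = "\<lambda>_. 0"])
    show "eventually (\<lambda>k. \<bar>h (k\<^sup>2) / (real k)\<^sup>2\<bar> \<le> corrector_bound / (real k)\<^sup>2) sequentially"
      by (intro always_eventually allI)
         (auto simp: h_def abs_divide intro!: divide_right_mono corrector_exp_bound)
    show "(\<lambda>k. corrector_bound / (real k)\<^sup>2) \<longlonglongrightarrow> 0"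
      by real_asymp
  qed auto
  from tendsto_diff[OF mart this]
  have "(\<lambda>k. (potential (front t (k\<^sup>2)) - real (k\<^sup>2) * ladder_speed) / (real k)\<^sup>2 - h (k\<^sup>2) / (real k)\<^sup>2 + ladder_speed)
      \<longlonglongrightarrow> 0 - 0 + ladder_speed"
    by (intro tendsto_add tendsto_const) simp
  \<comment> \<open>At k = 0 the quotients are 0 and the identity reads
    \<open>ladder_speed = 0\<close>, so it is claimed only eventually.\<close>
  moreover have "eventually (\<lambda>k. (potential (front t (k\<^sup>2)) - real (k\<^sup>2) * ladder_speed) / (real k)\<^sup>2 -
      h (k\<^sup>2) / (real k)\<^sup>2 + ladder_speed = T (k\<^sup>2) / (real k)\<^sup>2) sequentially"
    using eventually_gt_at_top[of 0] by eventually_elim (simp add: pot field_simps)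
  ultimately have "(\<lambda>k. T (k\<^sup>2) / (real k)\<^sup>2) \<longlonglongrightarrow> ladder_speed"
    by (simp add: tendsto_cong)
  then have T: "(\<lambda>n. T n / real n) \<longlonglongrightarrow> ladder_speed"
    using front_min[where t = t, OF t] by (intro LIMSEQ_ratio_of_squares) (simp_all add: T_def)
  show ?thesis
  proof (rule tendsto_sandwich)
    have "T n \<le> fst (front t n)" "fst (front t n) \<le> T n + t (Rung n)" for n
      using front_gap[where t = t and n = n, OF t] t[of "Rung n"] by (auto simp: T_def)
    then show "eventually (\<lambda>n. T n / real n \<le> fst (front t n) / real n) sequentially"
      "eventually (\<lambda>n. fst (front t n) / real n \<le> T n / real n + t (Rung n) / real n) sequentially"
      by (auto intro!: always_eventually divide_right_mono simp flip: add_divide_distrib)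
    show "(\<lambda>n. T n / real n + t (Rung n) / real n) \<longlonglongrightarrow> ladder_speed"
      using tendsto_add[OF T rung] by simp
  qed (rule T)
qed

section \<open>Independent exponential weights\<close>

text \<open>Dependence on the edges of the current ladder alone is what makes the state independent
  of the next column.\<close>

lemma front_cong:
  assumes "\<And>e. e \<in> ladder_edges n \<Longrightarrow> t e = t' e"
  shows "front t n = front t' n"
  using assms
proof (induction n)
  case (Suc n)
  have "ladder_edges n \<subseteq> ladder_edges (Suc n)"
    "{Bot (Suc n), Top (Suc n), Rung (Suc n)} \<subseteq> ladder_edges (Suc n)"
    by (auto simp: ladder_edges_def)
  with Suc show ?case
    by (metis (no_types, lifting) front.simps(2) insert_subset subset_eq)
qed (simp add: ladder_edges_def)

lemma measurable_front:
  "n \<le> N \<Longrightarrow> (\<lambda>t. front t n) \<in> measurable (PiM (ladder_edges N) (\<lambda>_. borel)) (borel \<Otimes>\<^sub>M borel)"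
proof (induction n)
  case 0
  have "Rung 0 \<in> ladder_edges N"
    by (auto simp: ladder_edges_def)
  then show ?case
    unfolding front.simps by measurable
next
  case (Suc n)
  then have [measurable]: "Bot (Suc n) \<in> ladder_edges N" "Top (Suc n) \<in> ladder_edges N"
    "Rung (Suc n) \<in> ladder_edges N"
    "(\<lambda>t. front t n) \<in> measurable (PiM (ladder_edges N) (\<lambda>_. borel)) (borel \<Otimes>\<^sub>M borel)"
    by (auto simp: ladder_edges_def)
  show ?case
    unfolding front.simps by measurable
qed

locale exponential_ladder = prob_space M for M :: "'a measure" +
  fixes w :: "ladder_edge \<Rightarrow> 'a \<Rightarrow> real"
  assumes indep: "indep_vars (\<lambda>_. borel) w UNIV"
    and exp_dist: "\<And>e. distributed M lborel (w e) (exponential_density 1)"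
begin

lemma measurable_w [measurable]: "w e \<in> borel_measurable M"
  using distributed_measurable[OF exp_dist[of e]] by simp

lemma distr_w: "distr M borel (w e) = std_exp"
proof -
  have "distr M borel (w e) = distr M lborel (w e)"
    by (rule distr_cong) auto
  then show ?thesis
    using distributed_distr_eq_density[OF exp_dist[of e]] by simp
qed

lemma AE_w_nonneg: "AE \<omega> in M. \<forall>e. 0 \<le> w e \<omega>"
proof -
  have "countable (UNIV :: ladder_edge set)"
  proof (rule countable_subset)
    show "(UNIV :: ladder_edge set) \<subseteq> range Bot \<union> range Top \<union> range Rung"
      by (auto simp: image_iff) (metis ladder_edge.exhaust)
  qed auto
  moreover have "AE \<omega> in M. 0 \<le> w e \<omega>" for e
  proof -
    have "AE x in distr M borel (w e). 0 \<le> x"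
      unfolding distr_w by (rule AE_std_exp_nonneg)
    then show ?thesis
      by (subst (asm) AE_distr_iff) auto
  qed
  ultimately show ?thesis
    using AE_ball_countable[of "UNIV :: ladder_edge set" "\<lambda>\<omega> e. 0 \<le> w e \<omega>" M] by simp
qed

definition column :: "nat \<Rightarrow> 'a \<Rightarrow> real \<times> real \<times> real" where
  "column n \<omega> = (w (Bot n) \<omega>, w (Top n) \<omega>, w (Rung n) \<omega>)"

definition frontier :: "nat \<Rightarrow> 'a \<Rightarrow> real \<times> real" where
  "frontier n \<omega> = front (\<lambda>e. w e \<omega>) n"

lemma measurable_column [measurable]: "column n \<in> measurable M (borel \<Otimes>\<^sub>M borel \<Otimes>\<^sub>M borel)"
  unfolding column_def by measurable

text \<open>Independence survives grouping into disjoint blocks of edges and taking measurable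
  images. It is expressed as a product of image measures so that Fubini applies directly.\<close>

lemma distr_disjoint_edges:
  assumes AB: "A \<inter> B = {}"
    and f: "f \<in> measurable (PiM A (\<lambda>_. borel)) S" and g: "g \<in> measurable (PiM B (\<lambda>_. borel)) T"
  shows "distr M (S \<Otimes>\<^sub>M T) (\<lambda>\<omega>. (f (restrict (\<lambda>e. w e \<omega>) A), g (restrict (\<lambda>e. w e \<omega>) B))) =
    distr M S (\<lambda>\<omega>. f (restrict (\<lambda>e. w e \<omega>) A)) \<Otimes>\<^sub>M distr M T (\<lambda>\<omega>. g (restrict (\<lambda>e. w e \<omega>) B))"
proof -
  let ?A = "PiM A (\<lambda>_. borel :: real measure)" and ?B = "PiM B (\<lambda>_. borel :: real measure)"
  let ?X = "\<lambda>\<omega>. restrict (\<lambda>e. w e \<omega>) A" and ?Y = "\<lambda>\<omega>. restrict (\<lambda>e. w e \<omega>) B"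
  have "indep_var ?A ?X ?B ?Y"
    using AB by (intro indep_var_restrict[OF indep]) auto
  then have X: "?X \<in> measurable M ?A" and Y: "?Y \<in> measurable M ?B"
    and XY: "distr M ?A ?X \<Otimes>\<^sub>M distr M ?B ?Y = distr M (?A \<Otimes>\<^sub>M ?B) (\<lambda>\<omega>. (?X \<omega>, ?Y \<omega>))"
    unfolding indep_var_distribution_eq by auto
  have "prob_space (distr (distr M ?B ?Y) T g)"
    using Y g by (intro prob_space.prob_space_distr prob_space_distr) auto
  then have "distr (distr M ?A ?X) S f \<Otimes>\<^sub>M distr (distr M ?B ?Y) T g =
      distr (distr M ?A ?X \<Otimes>\<^sub>M distr M ?B ?Y) (S \<Otimes>\<^sub>M T) (\<lambda>(x, y). (f x, g y))"
    using f g by (intro pair_measure_distr prob_space_imp_sigma_finite) auto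
  then show ?thesis
    using X Y f g unfolding XY
    by (subst (asm) (1 2 3) distr_distr) (auto simp: comp_def intro!: measurable_Pair)
qed

lemma distr_column: "distr M (borel \<Otimes>\<^sub>M borel \<Otimes>\<^sub>M borel) (column n) = exp_triple"
proof -
  have yz: "distr M (borel \<Otimes>\<^sub>M borel) (\<lambda>\<omega>. (w (Top n) \<omega>, w (Rung n) \<omega>)) = std_exp \<Otimes>\<^sub>M std_exp"
    using distr_disjoint_edges[of "{Top n}" "{Rung n}" "\<lambda>t. t (Top n)" borel "\<lambda>t. t (Rung n)" borel]
    by (simp add: distr_w measurable_component_singleton)
  have "(\<lambda>t. (t (Top n), t (Rung n))) \<in> measurable (PiM {Top n, Rung n} (\<lambda>_. borel)) (borel \<Otimes>\<^sub>M borel)"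
    by (intro measurable_Pair measurable_component_singleton) auto
  then show ?thesis
    using distr_disjoint_edges[of "{Bot n}" "{Top n, Rung n}" "\<lambda>t. t (Bot n)" borel
        "\<lambda>t. (t (Top n), t (Rung n))" "borel \<Otimes>\<^sub>M borel"]
    by (simp add: distr_w yz measurable_component_singleton column_def[abs_def])
qed

lemma frontier_restrict: "front (restrict (\<lambda>e. w e \<omega>) (ladder_edges n)) n = frontier n \<omega>"
  by (auto simp: frontier_def intro!: front_cong)

lemma measurable_frontier [measurable]: "frontier n \<in> measurable M (borel \<Otimes>\<^sub>M borel)"
proof -
  have "(\<lambda>\<omega>. front (restrict (\<lambda>e. w e \<omega>) (ladder_edges n)) n) \<in> measurable M (borel \<Otimes>\<^sub>M borel)"
    by (rule measurable_compose[OF measurable_restrict measurable_front]) auto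
  then show ?thesis
    by (simp add: frontier_restrict)
qed

text \<open>This plays the role of the Markov property: the new column can be integrated out with
  the state held fixed, in place of conditional expectations.\<close>

lemma distr_frontier_column:
  "distr M ((borel \<Otimes>\<^sub>M borel) \<Otimes>\<^sub>M (borel \<Otimes>\<^sub>M borel \<Otimes>\<^sub>M borel)) (\<lambda>\<omega>. (frontier n \<omega>, column (Suc n) \<omega>)) =
    distr M (borel \<Otimes>\<^sub>M borel) (frontier n) \<Otimes>\<^sub>M exp_triple"
proof -
  let ?B = "{Bot (Suc n), Top (Suc n), Rung (Suc n)}"
  let ?g = "\<lambda>t. (t (Bot (Suc n)), t (Top (Suc n)), t (Rung (Suc n))) :: real \<times> real \<times> real"
  have "?g \<in> measurable (PiM ?B (\<lambda>_. borel)) (borel \<Otimes>\<^sub>M borel \<Otimes>\<^sub>M borel)"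
    by (intro measurable_Pair measurable_component_singleton) auto
  moreover have "ladder_edges n \<inter> ?B = {}"
    by (auto simp: ladder_edges_def)
  moreover have "?g (restrict (\<lambda>e. w e \<omega>) ?B) = column (Suc n) \<omega>" for \<omega>
    by (simp add: column_def)
  ultimately show ?thesis
    using distr_disjoint_edges[of "ladder_edges n" ?B "\<lambda>t. front t n" "borel \<Otimes>\<^sub>M borel" ?g
        "borel \<Otimes>\<^sub>M borel \<Otimes>\<^sub>M borel"] measurable_front[OF order_refl, of n]
    by (simp only: frontier_restrict distr_column simp_thms)
qed

lemma frontier_Suc: "frontier (Suc n) \<omega> = ladder_step (frontier n \<omega>) (column (Suc n) \<omega>)"
  by (simp add: frontier_def column_def)

section \<open>Linear growth of the second moments and the almost sure limit\<close>

lemma frontier_second_moment_Suc: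
  "(\<integral>\<^sup>+\<omega>. ennreal ((potential (frontier (Suc n) \<omega>) - real (Suc n) * ladder_speed)\<^sup>2) \<partial>M) \<le>
    (\<integral>\<^sup>+\<omega>. ennreal ((potential (frontier n \<omega>) - real n * ladder_speed)\<^sup>2) \<partial>M) + ennreal variance_bound"
proof -
  let ?r = "real n * ladder_speed"
  let ?F = "borel \<Otimes>\<^sub>M borel :: (real \<times> real) measure"
  let ?C = "borel \<Otimes>\<^sub>M borel \<Otimes>\<^sub>M borel :: (real \<times> real \<times> real) measure"
  define g where "g = (\<lambda>q. ennreal ((potential (ladder_step (fst q) (snd q)) - ladder_speed - ?r)\<^sup>2))"
  have [measurable]: "g \<in> borel_measurable (?F \<Otimes>\<^sub>M ?C)"
    unfolding g_def by measurable
  interpret T: prob_space exp_triple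
    by (rule prob_space_exp_triple)
  have d: "distr M (?F \<Otimes>\<^sub>M ?C) (\<lambda>\<omega>. (frontier n \<omega>, column (Suc n) \<omega>)) = distr M ?F (frontier n) \<Otimes>\<^sub>M exp_triple"
    by (rule distr_frontier_column)
  have "sets (distr M ?F (frontier n) \<Otimes>\<^sub>M exp_triple) = sets (?F \<Otimes>\<^sub>M ?C)"
    by (intro sets_pair_measure_cong) auto
  then have g': "g \<in> borel_measurable (distr M ?F (frontier n) \<Otimes>\<^sub>M exp_triple)"
    by (subst measurable_cong_sets) (auto)
  have "(\<integral>\<^sup>+\<omega>. ennreal ((potential (frontier (Suc n) \<omega>) - real (Suc n) * ladder_speed)\<^sup>2) \<partial>M) =
      (\<integral>\<^sup>+\<omega>. g (frontier n \<omega>, column (Suc n) \<omega>) \<partial>M)"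
    by (simp add: g_def frontier_Suc algebra_simps)
  also have "\<dots> = (\<integral>\<^sup>+q. g q \<partial>distr M (?F \<Otimes>\<^sub>M ?C) (\<lambda>\<omega>. (frontier n \<omega>, column (Suc n) \<omega>)))"
    by (subst nn_integral_distr) auto
  also have "\<dots> = (\<integral>\<^sup>+s. \<integral>\<^sup>+p. g (s, p) \<partial>exp_triple \<partial>distr M ?F (frontier n))"
    unfolding d by (rule T.nn_integral_fst[OF g', symmetric])
  also have "\<dots> \<le> (\<integral>\<^sup>+s. ennreal ((potential s - ?r)\<^sup>2) + ennreal variance_bound \<partial>distr M ?F (frontier n))"
    unfolding g_def by (intro nn_integral_mono) (simp add: potential_second_moment_step)
  also have "\<dots> = (\<integral>\<^sup>+\<omega>. ennreal ((potential (frontier n \<omega>) - ?r)\<^sup>2) + ennreal variance_bound \<partial>M)"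
    by (subst nn_integral_distr) auto
  also have "\<dots> = (\<integral>\<^sup>+\<omega>. ennreal ((potential (frontier n \<omega>) - ?r)\<^sup>2) \<partial>M) + ennreal variance_bound"
    by (subst nn_integral_add) (auto simp: emeasure_space_1)
  finally show ?thesis .
qed

lemma frontier_second_moment:
  "(\<integral>\<^sup>+\<omega>. ennreal ((potential (frontier n \<omega>) - real n * ladder_speed)\<^sup>2) \<partial>M) \<le>
    ennreal (corrector_bound\<^sup>2 + real n * variance_bound)"
proof (induction n)
  case 0
  have "(\<integral>\<^sup>+\<omega>. ennreal ((potential (frontier 0 \<omega>) - real 0 * ladder_speed)\<^sup>2) \<partial>M) \<le>
      (\<integral>\<^sup>+\<omega>. ennreal (corrector_bound\<^sup>2) \<partial>M)"
    using AE_w_nonneg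
  proof (intro nn_integral_mono_AE, eventually_elim)
    case (elim \<omega>)
    \<comment> \<open>In column 0 the minimum is 0, so only the corrector contributes.\<close>
    then have "\<bar>potential (frontier 0 \<omega>)\<bar> \<le> corrector_bound"
      using corrector_exp_bound[of "w (Rung 0) \<omega>"] by (simp add: potential_def frontier_def)
    then have "(potential (frontier 0 \<omega>))\<^sup>2 \<le> corrector_bound\<^sup>2"
      by (metis abs_ge_zero power2_abs power_mono)
    then show ?case
      by (simp add: ennreal_leI)
  qed
  then show ?case
    by (simp add: emeasure_space_1)
next
  case (Suc n)
  have "(\<integral>\<^sup>+\<omega>. ennreal ((potential (frontier (Suc n) \<omega>) - real (Suc n) * ladder_speed)\<^sup>2) \<partial>M) \<le>
      ennreal (corrector_bound\<^sup>2 + real n * variance_bound) + ennreal variance_bound"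
    using frontier_second_moment_Suc[of n] Suc by (meson add_right_mono order_trans)
  also have "\<dots> = ennreal (corrector_bound\<^sup>2 + real (Suc n) * variance_bound)"
    using variance_bound_nonneg by (simp add: algebra_simps flip: ennreal_plus)
  finally show ?case .
qed

text \<open>After division by n the bound on the second moment is of order 1/n, which is not
  summable; along n = k^2 it is of order 1/k^2.\<close>

lemma AE_potential_frontier_squares:
  "AE \<omega> in M. (\<lambda>k. (potential (frontier (k\<^sup>2) \<omega>) - real (k\<^sup>2) * ladder_speed) / (real k)\<^sup>2) \<longlonglongrightarrow> 0"
proof (rule AE_tendsto_zero_of_second_moments)
  let ?D = "corrector_bound\<^sup>2 + variance_bound"
  show "(\<integral>\<^sup>+\<omega>. ennreal (((potential (frontier (k\<^sup>2) \<omega>) - real (k\<^sup>2) * ladder_speed) / (real k)\<^sup>2)\<^sup>2) \<partial>M)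
      \<le> ennreal (?D / (real k)\<^sup>2)" for k
  \<comment> \<open>For k = 0 both sides are 0, since division by zero yields 0.\<close>
  proof (cases "k = 0")
    case False
    have "(\<integral>\<^sup>+\<omega>. ennreal (((potential (frontier (k\<^sup>2) \<omega>) - real (k\<^sup>2) * ladder_speed) / (real k)\<^sup>2)\<^sup>2) \<partial>M) =
        (\<integral>\<^sup>+\<omega>. ennreal (1 / (real k)^4) *
          ennreal ((potential (frontier (k\<^sup>2) \<omega>) - real (k\<^sup>2) * ladder_speed)\<^sup>2) \<partial>M)"
      by (intro nn_integral_cong) (simp add: power_divide flip: ennreal_mult)
    also have "\<dots> = ennreal (1 / (real k)^4) *
        (\<integral>\<^sup>+\<omega>. ennreal ((potential (frontier (k\<^sup>2) \<omega>) - real (k\<^sup>2) * ladder_speed)\<^sup>2) \<partial>M)"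
      by (rule nn_integral_cmult) measurable
    also have "\<dots> \<le> ennreal (1 / (real k)^4) * ennreal (corrector_bound\<^sup>2 + real (k\<^sup>2) * variance_bound)"
      by (intro mult_left_mono frontier_second_moment) auto
    also have "\<dots> = ennreal (1 / (real k)^4 * (corrector_bound\<^sup>2 + real (k\<^sup>2) * variance_bound))"
      using variance_bound_nonneg by (subst ennreal_mult) auto
    also have "\<dots> \<le> ennreal (?D / (real k)\<^sup>2)"
    proof (rule ennreal_leI)
      have "1 * corrector_bound\<^sup>2 \<le> (real k)\<^sup>2 * corrector_bound\<^sup>2"
        using False by (intro mult_right_mono) auto
      then have "corrector_bound\<^sup>2 + real (k\<^sup>2) * variance_bound \<le> (real k)\<^sup>2 * ?D"
        by (simp add: algebra_simps)
      then have "1 / (real k)^4 * (corrector_bound\<^sup>2 + real (k\<^sup>2) * variance_bound) \<le> 1 / (real k)^4 * ((real k)\<^sup>2 * ?D)"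
        by (intro mult_left_mono) auto
      also have "\<dots> = ?D / (real k)\<^sup>2"
        using False by (simp add: field_simps power4_eq_xxxx power2_eq_square)
      finally show "1 / (real k)^4 * (corrector_bound\<^sup>2 + real (k\<^sup>2) * variance_bound) \<le> ?D / (real k)\<^sup>2" .
    qed
    finally show ?thesis .
  qed simp
qed (auto intro!: summable_const_over_square simp: variance_bound_nonneg)

text \<open>A single weight has second moment 2, so the bounds are summable along all n, in contrast
  to those for the martingale.\<close>

lemma AE_rung_sublinear: "AE \<omega> in M. (\<lambda>n. w (Rung n) \<omega> / real n) \<longlonglongrightarrow> 0"
proof (rule AE_tendsto_zero_of_second_moments)
  show "(\<integral>\<^sup>+\<omega>. ennreal ((w (Rung n) \<omega> / real n)\<^sup>2) \<partial>M) \<le> ennreal (2 / (real n)\<^sup>2)" for n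
  proof -
    have "(\<integral>\<^sup>+\<omega>. ennreal ((w (Rung n) \<omega> / real n)\<^sup>2) \<partial>M) =
        (\<integral>\<^sup>+\<omega>. ennreal (1 / (real n)\<^sup>2) * ennreal ((w (Rung n) \<omega>)\<^sup>2) \<partial>M)"
      by (intro nn_integral_cong) (simp add: power_divide flip: ennreal_mult)
    also have "\<dots> = ennreal (1 / (real n)\<^sup>2) * (\<integral>\<^sup>+\<omega>. ennreal ((w (Rung n) \<omega>)\<^sup>2) \<partial>M)"
      by (rule nn_integral_cmult) measurable
    also have "(\<integral>\<^sup>+\<omega>. ennreal ((w (Rung n) \<omega>)\<^sup>2) \<partial>M) = (\<integral>\<^sup>+x. ennreal (x\<^sup>2) \<partial>distr M borel (w (Rung n)))"
      by (subst nn_integral_distr) auto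
    also have "\<dots> = ennreal 2"
      unfolding distr_w nn_integral_std_exp_square by simp
    also have "ennreal (1 / (real n)\<^sup>2) * ennreal 2 = ennreal (2 / (real n)\<^sup>2)"
      by (subst ennreal_mult[symmetric]) auto
    finally show ?thesis
      by simp
  qed
qed (auto intro!: summable_const_over_square)

lemma AE_passage_time_speed:
  "AE \<omega> in M. (\<lambda>n. passage_time (\<lambda>e. w e \<omega>) n / real n) \<longlonglongrightarrow> ladder_speed"
  using AE_w_nonneg AE_rung_sublinear AE_potential_frontier_squares
proof eventually_elim
  case (elim \<omega>)
  then have "\<And>e. 0 \<le> w e \<omega>"
    by simp
  from front_speed[where t = "\<lambda>e. w e \<omega>", OF this elim(2) elim(3)[unfolded frontier_def]]
    passage_time_eq_front[where t = "\<lambda>e. w e \<omega>", OF this]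
  show ?case
    by simp
qed

end

theorem mainTheorem11:
  fixes M :: "'a measure" and w :: "ladder_edge \<Rightarrow> 'a \<Rightarrow> real"
  assumes "prob_space M"
    and "prob_space.indep_vars M (\<lambda>_. borel) w UNIV"
    and "\<And>e. distributed M lborel (w e) (exponential_density 1)"
  shows "AE \<omega> in M. (\<lambda>n. passage_time (\<lambda>e. w e \<omega>) n / real n)
            \<longlonglongrightarrow> 3 / 2 - besselJ 1 2 / (2 * besselJ 2 2)"
proof -
  interpret exponential_ladder M w
    using assms by (intro exponential_ladder.intro exponential_ladder_axioms.intro)
  show ?thesis
    using AE_passage_time_speed by (simp only: ladder_speed_def)
qed

end
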